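(* Let $0<R<1$, let $K=\{z\in\mathbb{C}: R<|z|<1\}$, and write $z=re^{i\varphi}$. Let $h:\mathbb{R}\to\mathbb{R}$ be a continuous $2\pi$-periodic function. Let $u=u(r,\varphi)$ be a real-valued function that is continuous on the closed ring $\overline{K}$, satisfies Laplace's equation $$\frac{1}{r}\frac{\partial}{\partial r}\left(r\frac{\partial u}{\partial r}\right)+\frac{1}{r^2}\frac{\partial^2 u}{\partial\varphi^2}=0$$ in $K$, and satisfies the Cauchy conditions $$u\big|_{r=1}=0,\qquad \frac{\partial u}{\partial n}\Big|_{r=1}=h(\varphi) .$$ Then for every $z=re^{i\varphi}$ with $R<|z|<1$, $$u(r,\varphi)=-\frac{1}{2\pi}\int_0^{2\pi}h(\psi)\,d\psi\cdot\ln r+\frac{1}{2\pi}\int_0^\infty\frac{1}{\lambda}\left(e^{-\lambda/r}-e^{-\lambda r}\right)\int_0^{2\pi}e^{\lambda\cos(\varphi-\psi)}\cos\left(\lambda\sin(\varphi-\psi)\right)h(\psi)\,d\psi\,d\lambda .$$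
   Context: $\partial u/\partial n$ at $r=1$ denotes the normal derivative on the unit circle in the outward direction, i.e. the radial derivative $\partial u/\partial r$ at $r=1$ (taken one-sidedly from inside $K$). The double integral is an iterated integral: the inner integral over $\psi$ is computed first, and then the improper integral over $\lambda\in(0,\infty)$. *)

theory Defs
  imports "HOL-Analysis.Analysis"
begin

text \<open>
  A function on the plane is read in polar coordinates through \<open>rcis r \<phi> = r * cis \<phi>\<close>.
  Since \<open>deriv\<close> is total, \<open>polar_laplacian\<close> is meaningful only where the derivatives
  involved exist; \<open>laplace_eq_ring\<close> demands that existence explicitly. No continuity of the
  partial derivatives is required.
\<close>

definition polar_laplacian :: "(complex \<Rightarrow> real) \<Rightarrow> real \<Rightarrow> real \<Rightarrow> real" where
  "polar_laplacian u r \<phi> =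
     1 / r * deriv (\<lambda>s. s * deriv (\<lambda>t. u (rcis t \<phi>)) s) r
     + 1 / r\<^sup>2 * deriv (deriv (\<lambda>\<psi>. u (rcis r \<psi>))) \<phi>"

definition laplace_eq_ring :: "real \<Rightarrow> (complex \<Rightarrow> real) \<Rightarrow> bool" where
  "laplace_eq_ring R u \<longleftrightarrow>
     (\<forall>r \<phi>. R < r \<and> r < 1 \<longrightarrow>
        (\<lambda>t. u (rcis t \<phi>)) field_differentiable at r \<and>
        (\<lambda>s. s * deriv (\<lambda>t. u (rcis t \<phi>)) s) field_differentiable at r \<and>
        (\<lambda>\<psi>. u (rcis r \<psi>)) field_differentiable at \<phi> \<and>
        deriv (\<lambda>\<psi>. u (rcis r \<psi>)) field_differentiable at \<phi> \<and>
        polar_laplacian u r \<phi> = 0)"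

definition cauchy_kernel_integrand :: "(real \<Rightarrow> real) \<Rightarrow> real \<Rightarrow> real \<Rightarrow> real \<Rightarrow> real" where
  "cauchy_kernel_integrand h r \<phi> \<mu> =
     1 / \<mu> * (exp (- \<mu> / r) - exp (- \<mu> * r)) *
     integral {0..2 * pi}
       (\<lambda>\<psi>. exp (\<mu> * cos (\<phi> - \<psi>)) * cos (\<mu> * sin (\<phi> - \<psi>)) * h \<psi>)"

end

theory Submission
  imports Defs "HOL-Probability.Distributions"
begin

text \<open>
  Put \<open>G\<^sub>0 = ln\<close> and \<open>G\<^sub>n t = (t ^ n - t ^ (-n)) / (2 * n)\<close>. The functions
  \<open>G\<^sub>n r * Re (c * cis (n * \<phi>))\<close> are harmonic, vanish at \<open>r = 1\<close> and have normal derivative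
  \<open>Re (c * cis (n * \<phi>))\<close> there. Trigonometric polynomials are dense in the continuous functions
  on the inner circle, so by the maximum principle (which needs only the separate second
  derivatives) finite sums of these functions approximate \<open>u\<close> uniformly on the ring. Comparing
  Fourier coefficients on the inner circle expands \<open>u\<close> in a series of these functions whose
  coefficients decay like \<open>n * R ^ n\<close>. Hence it may be differentiated termwise at \<open>r = 1\<close>, and its
  coefficients are those of \<open>h\<close>. On the other side, the inner integral of the formula is a power
  series in \<open>\<lambda>\<close> with the same coefficients, and
  \<open>\<integral>\<^sub>0\<^sup>\<infinity> (exp (- \<lambda> / r) - exp (- \<lambda> * r)) / \<lambda> * \<lambda> ^ n / n! d\<lambda> = 2 * G\<^sub>n r\<close>.
  The mode \<open>n = 0\<close> thus comes out twice, which the \<open>ln r\<close> term of the formula corrects.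
\<close>

section \<open>The maximum principle\<close>

text \<open>If \<open>D > 0\<close>, then \<open>w * f'\<close> increases through the value 0 at
  \<open>x\<close>, so \<open>f'\<close> is positive just to the right and the mean value theorem
  pushes \<open>f\<close> above its maximum. The weight \<open>w\<close> covers both the radial
  operator, with \<open>w t = t\<close>, and the angular one, with \<open>w t = 1\<close>.\<close>

lemma second_derivative_at_local_max:
  fixes f f' w :: "real \<Rightarrow> real"
  assumes "d > 0"
    and max: "\<And>t. \<bar>t - x\<bar> < d \<Longrightarrow> f t \<le> f x"
    and deriv: "\<And>t. \<bar>t - x\<bar> < d \<Longrightarrow> (f has_real_derivative f' t) (at t)"
    and pos: "\<And>t. \<bar>t - x\<bar> < d \<Longrightarrow> w t > 0"
    and D: "((\<lambda>t. w t * f' t) has_real_derivative D) (at x)"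
  shows "D \<le> 0"
proof (rule ccontr)
  assume "\<not> D \<le> 0"
  have f'x: "f' x = 0"
    using DERIV_local_max[OF deriv[of x] \<open>d > 0\<close>] max \<open>d > 0\<close> by (auto simp: abs_minus_commute)
  obtain e where e: "e > 0" "\<And>h. 0 < h \<Longrightarrow> h < e \<Longrightarrow> w x * f' x < w (x + h) * f' (x + h)"
    using DERIV_pos_inc_right[OF D] \<open>\<not> D \<le> 0\<close> by auto
  define h where "h = min d e / 2"
  have h: "0 < h" "h < d" "h < e" using \<open>d > 0\<close> e by (auto simp: h_def)
  obtain z where z: "z > x" "z < x + h" "f (x + h) - f x = (x + h - x) * f' z"
    using MVT2[of x "x + h" f f'] deriv h by auto
  have "w z * f' z > 0" using e(2)[of "z - x"] z h f'x by auto
  moreover have "w z > 0" using pos[of z] z h by auto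
  ultimately have "f' z > 0" by (simp add: zero_less_mult_iff)
  then have "f (x + h) > f x" using z h by (simp add: algebra_simps zero_less_mult_iff)
  moreover have "f (x + h) \<le> f x" using max[of "x + h"] h by auto
  ultimately show False by simp
qed

text \<open>The derivatives are existentially quantified functions instead of \<open>deriv\<close>
  terms, so that closure under linear combinations reduces to the derivative rules.\<close>

definition polar_harmonic :: "real \<Rightarrow> (complex \<Rightarrow> real) \<Rightarrow> bool" where
  "polar_harmonic R u \<longleftrightarrow> (\<exists>p q a b. \<forall>r \<phi>. R < r \<and> r < 1 \<longrightarrow>
     ((\<lambda>t. u (rcis t \<phi>)) has_real_derivative p r \<phi>) (at r) \<and>
     ((\<lambda>t. t * p t \<phi>) has_real_derivative a r \<phi>) (at r) \<and>
     ((\<lambda>t. u (rcis r t)) has_real_derivative q r \<phi>) (at \<phi>) \<and>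
     (q r has_real_derivative b r \<phi>) (at \<phi>) \<and>
     1 / r * a r \<phi> + 1 / r\<^sup>2 * b r \<phi> = 0)"

lemma laplace_eq_ring_imp_polar_harmonic:
  assumes "laplace_eq_ring R u"
  shows "polar_harmonic R u"
  unfolding polar_harmonic_def
proof (intro exI allI impI)
  fix r \<phi> :: real assume r: "R < r \<and> r < 1"
  show "((\<lambda>t. u (rcis t \<phi>)) has_real_derivative deriv (\<lambda>t. u (rcis t \<phi>)) r) (at r) \<and>
     ((\<lambda>t. t * deriv (\<lambda>t. u (rcis t \<phi>)) t) has_real_derivative
        deriv (\<lambda>s. s * deriv (\<lambda>t. u (rcis t \<phi>)) s) r) (at r) \<and>
     ((\<lambda>t. u (rcis r t)) has_real_derivative deriv (\<lambda>\<psi>. u (rcis r \<psi>)) \<phi>) (at \<phi>) \<and>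
     (deriv (\<lambda>\<psi>. u (rcis r \<psi>)) has_real_derivative deriv (deriv (\<lambda>\<psi>. u (rcis r \<psi>))) \<phi>) (at \<phi>) \<and>
     1 / r * deriv (\<lambda>s. s * deriv (\<lambda>t. u (rcis t \<phi>)) s) r
       + 1 / r\<^sup>2 * deriv (deriv (\<lambda>\<psi>. u (rcis r \<psi>))) \<phi> = 0"
    using assms r unfolding laplace_eq_ring_def polar_laplacian_def
    by (simp add: DERIV_deriv_iff_field_differentiable)
qed

section \<open>Linear combinations of harmonic functions\<close>

lemma polar_harmonic_zero: "polar_harmonic R (\<lambda>z. 0)"
  unfolding polar_harmonic_def
  by (rule exI[of _ "\<lambda>_ _. 0"], rule exI[of _ "\<lambda>_ _. 0"], rule exI[of _ "\<lambda>_ _. 0"],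
      rule exI[of _ "\<lambda>_ _. 0"]) auto

lemma polar_harmonic_add_scaled:
  assumes "polar_harmonic R u" "polar_harmonic R v"
  shows "polar_harmonic R (\<lambda>z. u z + c * v z)"
proof -
  obtain p q a b where u: "\<And>r \<phi>. R < r \<and> r < 1 \<Longrightarrow>
     ((\<lambda>t. u (rcis t \<phi>)) has_real_derivative p r \<phi>) (at r) \<and>
     ((\<lambda>t. t * p t \<phi>) has_real_derivative a r \<phi>) (at r) \<and>
     ((\<lambda>t. u (rcis r t)) has_real_derivative q r \<phi>) (at \<phi>) \<and>
     (q r has_real_derivative b r \<phi>) (at \<phi>) \<and>
     1 / r * a r \<phi> + 1 / r\<^sup>2 * b r \<phi> = 0"
    using assms(1) unfolding polar_harmonic_def by blast
  obtain p' q' a' b' where v: "\<And>r \<phi>. R < r \<and> r < 1 \<Longrightarrow>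
     ((\<lambda>t. v (rcis t \<phi>)) has_real_derivative p' r \<phi>) (at r) \<and>
     ((\<lambda>t. t * p' t \<phi>) has_real_derivative a' r \<phi>) (at r) \<and>
     ((\<lambda>t. v (rcis r t)) has_real_derivative q' r \<phi>) (at \<phi>) \<and>
     (q' r has_real_derivative b' r \<phi>) (at \<phi>) \<and>
     1 / r * a' r \<phi> + 1 / r\<^sup>2 * b' r \<phi> = 0"
    using assms(2) unfolding polar_harmonic_def by blast
  have *: "((\<lambda>t. f t + c * g t) has_real_derivative F + c * G) (at x)"
    if "(f has_real_derivative F) (at x)" "(g has_real_derivative G) (at x)"
    for f g :: "real \<Rightarrow> real" and F G x
    using that by (auto intro!: derivative_eq_intros)
  show ?thesis
    unfolding polar_harmonic_def
  \<comment> \<open>The explicit abstractions in the goals below let unification find the witnesses,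
    which are the same linear combinations of the given derivatives.\<close>
  proof (intro exI allI impI conjI)
    fix r \<phi> :: real assume r: "R < r \<and> r < 1"
    show "((\<lambda>t. u (rcis t \<phi>) + c * v (rcis t \<phi>)) has_real_derivative
             (\<lambda>r \<phi>. p r \<phi> + c * p' r \<phi>) r \<phi>) (at r)"
      using u[OF r] v[OF r] by (auto intro: *)
    show "((\<lambda>t. t * (\<lambda>r \<phi>. p r \<phi> + c * p' r \<phi>) t \<phi>) has_real_derivative
             (\<lambda>r \<phi>. a r \<phi> + c * a' r \<phi>) r \<phi>) (at r)"
      using *[of "\<lambda>t. t * p t \<phi>" "a r \<phi>" r "\<lambda>t. t * p' t \<phi>" "a' r \<phi>"] u[OF r] v[OF r]
      by (simp add: algebra_simps)
    show "((\<lambda>t. u (rcis r t) + c * v (rcis r t)) has_real_derivative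
             (\<lambda>r \<phi>. q r \<phi> + c * q' r \<phi>) r \<phi>) (at \<phi>)"
      using u[OF r] v[OF r] by (auto intro: *)
    show "((\<lambda>r \<phi>. q r \<phi> + c * q' r \<phi>) r has_real_derivative
             (\<lambda>r \<phi>. b r \<phi> + c * b' r \<phi>) r \<phi>) (at \<phi>)"
      using u[OF r] v[OF r] by (auto intro: *)
    show "1 / r * (\<lambda>r \<phi>. a r \<phi> + c * a' r \<phi>) r \<phi>
            + 1 / r\<^sup>2 * (\<lambda>r \<phi>. b r \<phi> + c * b' r \<phi>) r \<phi> = 0"
    proof -
      have "1 / r * (a r \<phi> + c * a' r \<phi>) + 1 / r\<^sup>2 * (b r \<phi> + c * b' r \<phi>)
          = (1 / r * a r \<phi> + 1 / r\<^sup>2 * b r \<phi>) + c * (1 / r * a' r \<phi> + 1 / r\<^sup>2 * b' r \<phi>)"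
        by (simp add: algebra_simps)
      then show ?thesis using u[OF r] v[OF r] by simp
    qed
  qed
qed

lemma polar_harmonic_diff:
  assumes "polar_harmonic R u" "polar_harmonic R v"
  shows "polar_harmonic R (\<lambda>z. u z - v z)"
  using polar_harmonic_add_scaled[OF assms, of "- 1"] by simp

lemma polar_harmonic_sum:
  assumes "\<And>i. i \<in> I \<Longrightarrow> polar_harmonic R (f i)"
  shows "polar_harmonic R (\<lambda>z. \<Sum>i\<in>I. f i z)"
  using assms
proof (induction I rule: infinite_finite_induct)
  case (insert i I)
  then show ?case
    using polar_harmonic_add_scaled[of R "f i" "\<lambda>z. \<Sum>i\<in>I. f i z" 1] by simp
qed (auto simp: polar_harmonic_zero)

text \<open>Adding \<open>\<epsilon> * (cmod z)\<^sup>2\<close> raises the polar Laplacian to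
  \<open>4 * \<epsilon> > 0\<close>. At an interior maximum of the perturbed function, however, the
  radial and the angular term are both nonpositive.\<close>

lemma polar_harmonic_maximum_principle:
  fixes w :: "complex \<Rightarrow> real"
  assumes "0 < R" "R < 1"
    and cont: "continuous_on {z. R \<le> cmod z \<and> cmod z \<le> 1} w"
    and harm: "polar_harmonic R w"
    and inner: "\<And>\<theta>. w (rcis R \<theta>) \<le> M"
    and outer: "\<And>\<theta>. w (rcis 1 \<theta>) \<le> M"
    and r: "R \<le> r" "r \<le> 1"
  shows "w (rcis r \<phi>) \<le> M"
proof (rule ccontr)
  assume nle: "\<not> w (rcis r \<phi>) \<le> M"
  obtain p q a b where w: "\<And>r \<phi>. R < r \<and> r < 1 \<Longrightarrow>
     ((\<lambda>t. w (rcis t \<phi>)) has_real_derivative p r \<phi>) (at r) \<and>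
     ((\<lambda>t. t * p t \<phi>) has_real_derivative a r \<phi>) (at r) \<and>
     ((\<lambda>t. w (rcis r t)) has_real_derivative q r \<phi>) (at \<phi>) \<and>
     (q r has_real_derivative b r \<phi>) (at \<phi>) \<and>
     1 / r * a r \<phi> + 1 / r\<^sup>2 * b r \<phi> = 0"
    using harm unfolding polar_harmonic_def by blast
  \<comment> \<open>Half of the excess over \<open>M\<close>: the perturbation is at most \<epsilon>
    on the closed ring, so the boundary values of \<open>g\<close> stay below
    \<open>M + \<epsilon>\<close>, while \<open>g\<close> exceeds this at the offending
    point.\<close>
  define \<epsilon> where "\<epsilon> = (w (rcis r \<phi>) - M) / 2"
  have \<epsilon>: "\<epsilon> > 0" "w (rcis r \<phi>) > M + \<epsilon>" using nle by (auto simp: \<epsilon>_def field_simps)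
  define g where "g z = w z + \<epsilon> * (cmod z)\<^sup>2" for z
  define K where "K = {z. R \<le> cmod z \<and> cmod z \<le> 1}"
  have "K = cball 0 1 - ball 0 R" by (auto simp: K_def dist_norm)
  then have "compact K" by (simp add: compact_diff)
  moreover have z0: "rcis r \<phi> \<in> K" using r \<open>0 < R\<close> by (auto simp: K_def)
  moreover have "continuous_on K g"
    unfolding g_def using cont by (auto intro!: continuous_intros simp: K_def)
  ultimately obtain z where z: "z \<in> K" "\<And>y. y \<in> K \<Longrightarrow> g y \<le> g z"
    using continuous_attains_sup[of K g] by auto
  have "g z \<ge> g (rcis r \<phi>)" using z z0 by auto
  then have gz: "g z > M + \<epsilon>" using \<epsilon> unfolding g_def
    by (smt (verit) mult_nonneg_nonneg zero_le_power2)
  obtain s \<theta> where z_eq: "z = rcis s \<theta>" and s_eq: "s = cmod z" by (metis rcis_cmod_Arg)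
  have s: "R \<le> s" "s \<le> 1" using z(1) by (auto simp: s_eq K_def)
  have gle: "g (rcis t \<psi>) \<le> g z" if "R \<le> t" "t \<le> 1" for t \<psi>
    using that \<open>0 < R\<close> by (intro z) (auto simp: K_def)
  have g_rcis: "g (rcis t \<psi>) = w (rcis t \<psi>) + \<epsilon> * t\<^sup>2" for t \<psi> by (simp add: g_def)
  have "s \<noteq> R"
  proof
    assume "s = R"
    have "R\<^sup>2 \<le> 1" using \<open>0 < R\<close> \<open>R < 1\<close> by (simp add: power_le_one)
    then have "\<epsilon> * R\<^sup>2 \<le> \<epsilon>" using \<epsilon> by simp
    then have "g z \<le> M + \<epsilon>" using inner[of \<theta>] \<open>s = R\<close> by (simp add: z_eq g_rcis)
    then show False using gz by simp
  qed
  moreover have "s \<noteq> 1"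
  proof
    assume "s = 1"
    then have "g z \<le> M + \<epsilon>" using outer[of \<theta>] by (simp add: z_eq g_rcis)
    then show False using gz by simp
  qed
  ultimately have s: "R < s" "s < 1" using s by auto
  define d where "d = min (s - R) (1 - s)"
  have d: "d > 0" "\<And>t. \<bar>t - s\<bar> < d \<Longrightarrow> R < t \<and> t < 1" using s by (auto simp: d_def)
  \<comment> \<open>Radial direction with weight \<open>t\<close>: the perturbation contributes
    \<open>2 * \<epsilon> * t\<^sup>2\<close> to the weighted derivative, hence
    \<open>4 * \<epsilon> * s\<close>.\<close>
  have "a s \<theta> + 4 * \<epsilon> * s \<le> 0"
  proof (rule second_derivative_at_local_max[OF d(1)])
    fix t assume "\<bar>t - s\<bar> < d"
    then have t: "R < t" "t < 1" using d by auto
    show "g (rcis t \<theta>) \<le> g (rcis s \<theta>)" using gle[of t] t by (auto simp: z_eq)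
    show "((\<lambda>t. g (rcis t \<theta>)) has_real_derivative p t \<theta> + 2 * \<epsilon> * t) (at t)"
      unfolding g_rcis using w[of t \<theta>] t by (auto intro!: derivative_eq_intros)
    show "t > 0" using t \<open>0 < R\<close> by auto
  next
    have "((\<lambda>t. t * p t \<theta> + 2 * \<epsilon> * t\<^sup>2) has_real_derivative a s \<theta> + 4 * \<epsilon> * s) (at s)"
      by (intro DERIV_add) (use w[of s \<theta>] s in \<open>auto intro!: derivative_eq_intros\<close>)
    then show "((\<lambda>t. t * (p t \<theta> + 2 * \<epsilon> * t)) has_real_derivative a s \<theta> + 4 * \<epsilon> * s) (at s)"
      by (simp add: algebra_simps power2_eq_square)
  qed
  \<comment> \<open>On a circle the perturbation is constant and leaves no trace in the angular
    derivatives.\<close>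
  moreover have "b s \<theta> \<le> 0"
  proof (rule second_derivative_at_local_max[of 1])
    fix t
    show "g (rcis s t) \<le> g (rcis s \<theta>)" using gle[of s t] s by (auto simp: z_eq)
    show "((\<lambda>t. g (rcis s t)) has_real_derivative q s t) (at t)"
      unfolding g_rcis using w[of s t] s by (auto intro!: derivative_eq_intros)
    show "(1::real) > 0" by simp
  next
    show "((\<lambda>t. 1 * q s t) has_real_derivative b s \<theta>) (at \<theta>)"
      using w[of s \<theta>] s by simp
  qed simp
  moreover have "s > 0" using s \<open>0 < R\<close> by simp
  moreover from this have "4 * \<epsilon> * s > 0" using \<epsilon> by simp
  ultimately have "1 / s * a s \<theta> < 0" "1 / s\<^sup>2 * b s \<theta> \<le> 0"
    by (auto simp: field_simps mult_less_0_iff divide_less_0_iff divide_nonpos_pos)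
  then show False using w[of s \<theta>] s by simp
qed

section \<open>Density of trigonometric polynomials\<close>

text \<open>Nonnegative powers suffice for real trigonometric polynomials: the real part supplies
  the negative frequencies, and complex coefficients encode cosine and sine together.\<close>

definition trig_poly :: "(complex \<Rightarrow> real) \<Rightarrow> bool" where
  "trig_poly f \<longleftrightarrow> (\<exists>N c. \<forall>z\<in>sphere 0 1. f z = (\<Sum>n\<le>N. Re (c n * z ^ n)))"

lemma trig_poly_cong:
  assumes "trig_poly f" "\<And>z. cmod z = 1 \<Longrightarrow> f z = g z"
  shows "trig_poly g"
  using assms unfolding trig_poly_def by auto

lemma trig_poly_mode: "trig_poly (\<lambda>z. Re (a * z ^ n))"
  unfolding trig_poly_def
  by (rule exI[of _ n], rule exI[of _ "\<lambda>m. if m = n then a else 0"])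
     (auto simp: sum.remove[of _ n])

lemma trig_poly_add:
  assumes "trig_poly f" "trig_poly g"
  shows "trig_poly (\<lambda>z. f z + g z)"
proof -
  obtain N c where f: "\<And>z. cmod z = 1 \<Longrightarrow> f z = (\<Sum>n\<le>N. Re (c n * z ^ n))"
    using assms(1) unfolding trig_poly_def by auto
  obtain M d where g: "\<And>z. cmod z = 1 \<Longrightarrow> g z = (\<Sum>n\<le>M. Re (d n * z ^ n))"
    using assms(2) unfolding trig_poly_def by auto
  have pad: "(\<Sum>n\<le>N. Re (c n * z ^ n)) = (\<Sum>n\<le>L. Re ((if n \<le> N then c n else 0) * z ^ n))"
    if "N \<le> L" for N L z and c :: "nat \<Rightarrow> complex"
    using that by (intro sum.mono_neutral_cong_left) auto
  have "f z + g z = (\<Sum>n\<le>max N M.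
      Re (((if n \<le> N then c n else 0) + (if n \<le> M then d n else 0)) * z ^ n))"
    if "cmod z = 1" for z
    unfolding f[OF that] g[OF that] pad[OF max.cobounded1, of c z N M]
      pad[OF max.cobounded2, of d z M N] ring_distribs plus_complex.sel sum.distrib ..
  then show ?thesis
    unfolding trig_poly_def
    by (intro exI[of _ "max N M"]
        exI[of _ "\<lambda>n. (if n \<le> N then c n else 0) + (if n \<le> M then d n else 0)"])
       (rule ballI, simp only: mem_sphere_0)
qed

lemma trig_poly_sum:
  assumes "\<And>i. i \<in> I \<Longrightarrow> trig_poly (f i)"
  shows "trig_poly (\<lambda>z. \<Sum>i\<in>I. f i z)"
  using assms
  by (induction I rule: infinite_finite_induct)
     (use trig_poly_mode[of 0 0] in \<open>auto intro: trig_poly_add\<close>)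

text \<open>Product-to-sum formula \<open>Re v * Re w = (Re (v * w) + Re (v * cnj w)) / 2\<close>.
  On the unit circle conjugation inverts \<open>z ^ m\<close>, and \<open>m \<le> n\<close> keeps
  the exponent \<open>n - m\<close> a true difference.\<close>

lemma trig_poly_mode_mult:
  assumes "m \<le> n"
  shows "trig_poly (\<lambda>z. Re (a * z ^ n) * Re (b * z ^ m))"
proof (rule trig_poly_cong)
  show "trig_poly (\<lambda>z. Re ((a * b / 2) * z ^ (n + m)) + Re ((a * cnj b / 2) * z ^ (n - m)))"
    by (intro trig_poly_add trig_poly_mode)
  have Re_Re: "Re (v * w) / 2 + Re (v * cnj w) / 2 = Re v * Re w" for v w
    by (simp add: field_simps)
  fix z :: complex assume z: "cmod z = 1"
  have "z ^ n = z ^ (n - m) * z ^ m" using assms by (simp flip: power_add)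
  moreover have "z ^ m * cnj (z ^ m) = 1"
    unfolding complex_norm_square[symmetric] using z by (simp add: norm_power)
  ultimately have "z ^ (n - m) = z ^ n * cnj (z ^ m)" by (simp add: mult.assoc)
  then have "Re ((a * b / 2) * z ^ (n + m)) + Re ((a * cnj b / 2) * z ^ (n - m))
     = Re ((a * z ^ n) * (b * z ^ m)) / 2 + Re ((a * z ^ n) * cnj (b * z ^ m)) / 2"
    by (simp add: power_add mult_ac)
  also have "\<dots> = Re (a * z ^ n) * Re (b * z ^ m)"
    using Re_Re[of "a * z ^ n" "b * z ^ m"] by simp
  finally show "Re ((a * b / 2) * z ^ (n + m)) + Re ((a * cnj b / 2) * z ^ (n - m))
     = Re (a * z ^ n) * Re (b * z ^ m)" .
qed

lemma trig_poly_mult: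
  assumes "trig_poly f" "trig_poly g"
  shows "trig_poly (\<lambda>z. f z * g z)"
proof -
  obtain N c where f: "\<And>z. cmod z = 1 \<Longrightarrow> f z = (\<Sum>n\<le>N. Re (c n * z ^ n))"
    using assms(1) unfolding trig_poly_def by auto
  obtain M d where g: "\<And>z. cmod z = 1 \<Longrightarrow> g z = (\<Sum>n\<le>M. Re (d n * z ^ n))"
    using assms(2) unfolding trig_poly_def by auto
  have modes: "trig_poly (\<lambda>z. Re (a * z ^ n) * Re (b * z ^ m))" for a b n m
  proof (cases "m \<le> n")
    case True
    then show ?thesis by (rule trig_poly_mode_mult)
  next
    case False
    then show ?thesis using trig_poly_mode_mult[of n m b a] by (simp add: mult.commute)
  qed
  show ?thesis
  proof (rule trig_poly_cong)
    show "trig_poly (\<lambda>z. \<Sum>n\<le>N. \<Sum>m\<le>M. Re (c n * z ^ n) * Re (d m * z ^ m))"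
      by (intro trig_poly_sum modes)
  qed (simp only: f g sum_product)
qed

text \<open>Stone-Weierstrass on the unit circle: trigonometric polynomials form an algebra
  containing the constants, and \<open>Re\<close> and \<open>Im\<close> separate points.\<close>

lemma trig_poly_dense:
  assumes "continuous_on (sphere 0 1) F" "e > 0"
  shows "\<exists>N c. \<forall>\<theta>. \<bar>F (cis \<theta>) - (\<Sum>n\<le>N. Re (c n * cis (real n * \<theta>)))\<bar> < e"
proof -
  have "\<exists>g. (continuous_on (sphere 0 1) g \<and> trig_poly g) \<and> (\<forall>z\<in>sphere 0 1. \<bar>F z - g z\<bar> < e)"
  proof (rule Stone_Weierstrass_HOL)
    fix c :: real
    show "continuous_on (sphere 0 1) (\<lambda>z::complex. c) \<and> trig_poly (\<lambda>z. c)"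
      using trig_poly_mode[of "of_real c" 0] by simp
  next
    fix z w :: complex assume "z \<in> sphere 0 1 \<and> w \<in> sphere 0 1 \<and> z \<noteq> w"
    then have "Re z \<noteq> Re w \<or> Im z \<noteq> Im w" by (auto simp: complex_eq_iff)
    moreover have "trig_poly Re" using trig_poly_mode[of 1 1] by simp
    moreover have "trig_poly Im" using trig_poly_mode[of "- \<i>" 1] by simp
    ultimately show "\<exists>f. (continuous_on (sphere 0 1) f \<and> trig_poly f) \<and> f z \<noteq> f w"
      using continuous_on_Re[OF continuous_on_id] continuous_on_Im[OF continuous_on_id] by blast
  qed (use assms in \<open>auto intro: trig_poly_add trig_poly_mult continuous_intros\<close>)
  then obtain g where g: "trig_poly g" "\<And>z. cmod z = 1 \<Longrightarrow> \<bar>F z - g z\<bar> < e" by auto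
  obtain N c where c: "\<And>z. cmod z = 1 \<Longrightarrow> g z = (\<Sum>n\<le>N. Re (c n * z ^ n))"
    using g(1) unfolding trig_poly_def by auto
  have "\<bar>F (cis \<theta>) - (\<Sum>n\<le>N. Re (c n * cis (real n * \<theta>)))\<bar> < e" for \<theta>
    using g(2)[OF norm_cis, of \<theta>] unfolding c[OF norm_cis] Complex.DeMoivre .
  then show ?thesis by blast
qed

section \<open>Harmonic modes of the ring\<close>

text \<open>The solution of the Euler equation \<open>t * (t * G')' = n\<^sup>2 * G\<close> with
  value 0 and slope 1 at \<open>t = 1\<close>. The logarithm is the limit of the other branch as the
  exponent tends to 0.\<close>

definition ring_mode :: "nat \<Rightarrow> real \<Rightarrow> real" where
  "ring_mode n t = (if n = 0 then ln t else (t ^ n - inverse t ^ n) / (2 * real n))"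

lemma ring_mode_1 [simp]: "ring_mode n 1 = 0"
  by (simp add: ring_mode_def)

section \<open>Derivatives of the radial factors\<close>

lemma power_has_derivative_pos:
  fixes t :: real
  assumes "t > 0"
  shows "((\<lambda>t. t ^ n) has_real_derivative real n * t ^ n / t) (at t within S)"
    and "((\<lambda>t. inverse t ^ n) has_real_derivative - real n * inverse t ^ n / t) (at t within S)"
proof -
  \<comment> \<open>Dividing by \<open>x\<close> replaces the truncated exponent
    \<open>n - 1\<close>, so that the final formulas hold for \<open>n = 0\<close> as well.\<close>
  have *: "x ^ (n - Suc 0) = x ^ n / x" if "x > 0" "n > 0" for x :: real
    using that by (cases n) auto
  show "((\<lambda>t. t ^ n) has_real_derivative real n * t ^ n / t) (at t within S)"
    using assms by (cases "n = 0") (auto intro!: derivative_eq_intros simp: *)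
  show "((\<lambda>t. inverse t ^ n) has_real_derivative - real n * inverse t ^ n / t) (at t within S)"
    using assms by (cases "n = 0") (auto intro!: derivative_eq_intros simp: * field_simps)
qed

lemma ring_mode_has_derivative:
  assumes "t > 0"
  shows "(ring_mode n has_real_derivative (t ^ n + inverse t ^ n) / (2 * t)) (at t within S)"
proof (cases "n = 0")
  case True
  then have "ring_mode n = ln" by (simp add: fun_eq_iff ring_mode_def)
  then show ?thesis
    using assms True by (auto intro!: derivative_eq_intros)
next
  case False
  then have "ring_mode n = (\<lambda>t. (t ^ n - inverse t ^ n) / (2 * real n))"
    by (simp add: fun_eq_iff ring_mode_def)
  moreover have "(real n * t ^ n / t - (- real n * inverse t ^ n / t)) / (2 * real n)
      = (t ^ n + inverse t ^ n) / (2 * t)"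
    using False assms by (simp add: divide_simps) (simp add: algebra_simps)
  ultimately show ?thesis
    by (simp only:) (rule DERIV_cdivide[OF DERIV_diff[OF power_has_derivative_pos(1)[OF assms]
      power_has_derivative_pos(2)[OF assms]], where c = "2 * real n", THEN DERIV_cong])
qed

text \<open>The differentiated function is \<open>s\<close> times the derivative of
  \<open>ring_mode n\<close>, so this is the radial half of Laplace's equation. For
  \<open>n = 0\<close> both sides vanish.\<close>

lemma ring_mode_has_second_derivative:
  assumes "t > 0"
  shows "((\<lambda>s. (s ^ n + inverse s ^ n) / 2) has_real_derivative (real n)\<^sup>2 * ring_mode n t / t) (at t)"
proof -
  have "(real n * t ^ n / t + - real n * inverse t ^ n / t) / 2 = (real n)\<^sup>2 * ring_mode n t / t"
    by (simp add: ring_mode_def divide_simps power2_eq_square) (simp add: algebra_simps)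
  then show ?thesis
    by (rule DERIV_cdivide[OF DERIV_add[OF power_has_derivative_pos(1)[OF assms]
      power_has_derivative_pos(2)[OF assms]], where c = 2, THEN DERIV_cong])
qed

section \<open>Size of the radial factors\<close>

lemma power_le_inverse_power:
  fixes t :: real
  assumes "0 < t" "t \<le> 1"
  shows "t ^ n \<le> inverse t ^ n" "1 \<le> inverse t ^ n" "inverse t ^ n \<le> inverse t ^ Suc n"
proof -
  have t: "1 \<le> inverse t" using assms by (simp add: one_le_inverse)
  then show "1 \<le> inverse t ^ n" by (rule one_le_power)
  moreover have "t ^ n \<le> 1" using assms by (simp add: power_le_one)
  ultimately show "t ^ n \<le> inverse t ^ n" by simp
  show "inverse t ^ n \<le> inverse t ^ Suc n" using t by (intro power_increasing) auto
qed

text \<open>The exponent \<open>Suc n\<close> leaves room for the logarithm at \<open>n = 0\<close>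
  and matches the bound for the derivative below, so one majorant serves the series and its termwise
  derivative.\<close>

lemma ring_mode_abs_le:
  assumes "0 < t" "t \<le> 1"
  shows "\<bar>ring_mode n t\<bar> \<le> inverse t ^ Suc n"
proof (cases "n = 0")
  case True
  have "ln (inverse t) \<le> inverse t - 1" using assms by (intro ln_le_minus_one) auto
  then show ?thesis using True assms by (simp add: ring_mode_def ln_inverse)
next
  case False
  have "\<bar>ring_mode n t\<bar> = (inverse t ^ n - t ^ n) / (2 * real n)"
    using power_le_inverse_power(1)[OF assms, of n] False
    by (simp add: ring_mode_def abs_if field_simps)
  also have "\<dots> \<le> (inverse t ^ n - t ^ n) / 1"
    using power_le_inverse_power(1)[OF assms, of n] False by (intro divide_left_mono) auto
  also have "\<dots> \<le> inverse t ^ n" using assms by simp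
  also have "\<dots> \<le> inverse t ^ Suc n" by (rule power_le_inverse_power(3)[OF assms])
  finally show ?thesis .
qed

lemma ring_mode_deriv_abs_le:
  fixes t :: real
  assumes "0 < t" "t \<le> 1"
  shows "\<bar>(t ^ n + inverse t ^ n) / (2 * t)\<bar> \<le> inverse t ^ Suc n"
proof -
  have "\<bar>(t ^ n + inverse t ^ n) / (2 * t)\<bar> = (t ^ n + inverse t ^ n) / (2 * t)"
    using assms by simp
  also have "\<dots> \<le> (inverse t ^ n + inverse t ^ n) / (2 * t)"
    using power_le_inverse_power(1)[OF assms, of n] assms by (intro divide_right_mono) auto
  also have "\<dots> = inverse t ^ Suc n" by (simp add: field_simps)
  finally show ?thesis .
qed

lemma ring_mode_neg:
  assumes "0 < t" "t < 1"
  shows "ring_mode n t < 0"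
proof (cases "n = 0")
  case False
  have "t ^ n < 1" using assms False by (simp add: power_Suc_less_one power_less_one_iff)
  moreover have "1 \<le> inverse t ^ n" using assms by (intro power_le_inverse_power) auto
  ultimately show ?thesis using False by (simp add: ring_mode_def divide_neg_pos)
qed (use assms in \<open>simp add: ring_mode_def\<close>)

text \<open>A lower bound is needed because \<open>ring_mode n R\<close> appears as a divisor. It
  follows from \<open>t ^ (2 * n) \<le> t\<^sup>2\<close> for \<open>n > 0\<close>.\<close>

lemma ring_mode_abs_ge:
  assumes "0 < t" "t < 1" "n > 0"
  shows "(1 - t\<^sup>2) / (2 * real n * t ^ n) \<le> \<bar>ring_mode n t\<bar>"
proof -
  have "(t ^ n) * (t ^ n) = t ^ (2 * n)" by (simp add: mult_2 power_add)
  also have "\<dots> \<le> t ^ 2" using assms by (intro power_decreasing) auto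
  finally have "(1 - t\<^sup>2) / (2 * real n * t ^ n) \<le> (1 - t ^ n * t ^ n) / (2 * real n * t ^ n)"
    using assms by (intro divide_right_mono) auto
  also have "\<dots> = - ring_mode n t" using assms by (simp add: ring_mode_def field_simps)
  finally show ?thesis using ring_mode_neg[OF assms(1,2), of n] by simp
qed

text \<open>Up to a constant the terms are at most \<open>n * (R / s) ^ n\<close> for
  \<open>n > 0\<close>, a differentiated geometric series; its convergence rests on
  \<open>R < s\<close>.\<close>

lemma summable_ring_mode_ratio:
  assumes "0 < R" "R < s" "s \<le> 1"
  shows "summable (\<lambda>n. inverse s ^ Suc n / \<bar>ring_mode n R\<bar>)"
proof (rule summable_comparison_test)
  define q where "q = R / s"
  define C where "C = 2 * inverse s / (1 - R\<^sup>2)"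
  have R2: "R\<^sup>2 < 1" using assms by (simp add: power_less_one_iff)
  have "0 \<le> q" "q < 1" using assms by (auto simp: q_def)
  then have "summable (\<lambda>n. real (Suc n) * q ^ n)"
    using geometric_deriv_sums[of q] by (simp add: sums_iff)
  then show "summable (\<lambda>n. C * (real (Suc n) * q ^ n))" by (rule summable_mult)
  have "norm (inverse s ^ Suc n / \<bar>ring_mode n R\<bar>) \<le> C * (real (Suc n) * q ^ n)" if "n \<ge> 1" for n
  proof -
    have "R ^ n > 0" using assms by simp
    then have pos: "0 < (1 - R\<^sup>2) / (2 * real n * R ^ n)"
      using R2 that by (intro divide_pos_pos mult_pos_pos) auto
    have "norm (inverse s ^ Suc n / \<bar>ring_mode n R\<bar>) = inverse s ^ Suc n / \<bar>ring_mode n R\<bar>"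
      using assms by simp
    also have "\<dots> \<le> inverse s ^ Suc n / ((1 - R\<^sup>2) / (2 * real n * R ^ n))"
      using ring_mode_abs_ge[of R n] assms that pos
      by (intro divide_left_mono mult_pos_pos) auto
    also have "\<dots> = C * (real n * q ^ n)"
      using assms R2 by (simp add: C_def q_def field_simps power_divide)
    also have "\<dots> \<le> C * (real (Suc n) * q ^ n)"
      using R2 assms \<open>0 \<le> q\<close> unfolding C_def by (intro mult_left_mono mult_right_mono) auto
    finally show ?thesis .
  qed
  then show "\<exists>N. \<forall>n\<ge>N. norm (inverse s ^ Suc n / \<bar>ring_mode n R\<bar>) \<le> C * (real (Suc n) * q ^ n)"
    by blast
qed

section \<open>The modes as harmonic functions in the plane\<close>

definition ring_harmonic :: "nat \<Rightarrow> complex \<Rightarrow> complex \<Rightarrow> real" where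
  "ring_harmonic n c z = ring_mode n (cmod z) * Re (c * sgn z ^ n)"

text \<open>\<open>sgn z\<close> is the point of the unit circle in direction \<open>z\<close>, so
  the mode is defined on the plane without choosing a branch of the argument.\<close>

lemma ring_harmonic_rcis:
  assumes "t > 0"
  shows "ring_harmonic n c (rcis t \<phi>) = ring_mode n t * Re (c * cis (real n * \<phi>))"
proof -
  have "sgn (rcis t \<phi>) = cis \<phi>"
    using assms by (simp add: sgn_div_norm rcis_def scaleR_conv_of_real norm_mult)
  then show ?thesis
    using assms unfolding ring_harmonic_def by (simp only: Complex.DeMoivre) simp
qed

lemma continuous_on_ring_harmonic:
  assumes "0 \<notin> S"
  shows "continuous_on S (ring_harmonic n c)"
proof -
  have "sgn = (\<lambda>z::complex. z / of_real (cmod z))"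
    by (simp add: fun_eq_iff sgn_div_norm scaleR_conv_of_real divide_inverse mult.commute)
  then have "continuous_on S (\<lambda>z. Re (c * sgn z ^ n))"
    using assms by (auto intro!: continuous_intros)
  moreover have "continuous_on S (\<lambda>z. ring_mode n (cmod z))"
    unfolding ring_mode_def using assms by (cases "n = 0") (auto intro!: continuous_intros)
  ultimately show ?thesis
    unfolding ring_harmonic_def[abs_def] by (rule continuous_on_mult[rotated])
qed

text \<open>Separation of variables: the radial operator multiplies the mode by
  \<open>n\<^sup>2 / r\<^sup>2\<close>, and the angular one by the negative of this.\<close>

lemma polar_harmonic_ring_harmonic:
  assumes "0 \<le> R"
  shows "polar_harmonic R (ring_harmonic n c)"
  unfolding polar_harmonic_def
proof (intro exI allI impI conjI)
  fix r \<phi> :: real assume r: "R < r \<and> r < 1"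
  then have "r > 0" using assms by simp
  define E where "E \<phi> = Re (c * cis (real n * \<phi>))" for \<phi>
  define E' where "E' \<phi> = - Re c * sin (real n * \<phi>) - Im c * cos (real n * \<phi>)" for \<phi>
  have E: "(E has_real_derivative real n * E' \<phi>) (at \<phi>)"
    unfolding E_def[abs_def] E'_def by (auto intro!: derivative_eq_intros simp: algebra_simps)
  have E': "(E' has_real_derivative - real n * E \<phi>) (at \<phi>)"
    unfolding E_def E'_def[abs_def] by (auto intro!: derivative_eq_intros simp: algebra_simps)
  \<comment> \<open>The product formula for the modes holds for positive radii only, so functions of
    the radius are identified merely near \<open>r\<close>.\<close>
  have pos: "eventually (\<lambda>t. t > 0) (nhds r)"
    using \<open>r > 0\<close> eventually_nhds_in_open[of "{0<..}" r] by simp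
  show "((\<lambda>t. ring_harmonic n c (rcis t \<phi>)) has_real_derivative
      (\<lambda>r \<phi>. (r ^ n + inverse r ^ n) / (2 * r) * Re (c * cis (real n * \<phi>))) r \<phi>) (at r)"
  proof (rule DERIV_cong_ev[THEN iffD1])
    show "((\<lambda>t. ring_mode n t * E \<phi>) has_real_derivative
        (r ^ n + inverse r ^ n) / (2 * r) * E \<phi>) (at r)"
      by (rule DERIV_cmult_right[OF ring_mode_has_derivative[OF \<open>r > 0\<close>]])
    show "\<forall>\<^sub>F t in nhds r. ring_mode n t * E \<phi> = ring_harmonic n c (rcis t \<phi>)"
      using pos by eventually_elim (simp only: ring_harmonic_rcis E_def)
  qed (simp_all add: E_def)
  show "((\<lambda>t. t * (\<lambda>r \<phi>. (r ^ n + inverse r ^ n) / (2 * r) * Re (c * cis (real n * \<phi>))) t \<phi>)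
      has_real_derivative
      (\<lambda>r \<phi>. (real n)\<^sup>2 * ring_mode n r / r * Re (c * cis (real n * \<phi>))) r \<phi>) (at r)"
  proof (rule DERIV_cong_ev[THEN iffD1])
    show "((\<lambda>t. (t ^ n + inverse t ^ n) / 2 * E \<phi>) has_real_derivative
        (real n)\<^sup>2 * ring_mode n r / r * E \<phi>) (at r)"
      by (rule DERIV_cmult_right[OF ring_mode_has_second_derivative[OF \<open>r > 0\<close>]])
    show "\<forall>\<^sub>F t in nhds r. (t ^ n + inverse t ^ n) / 2 * E \<phi> =
       t * (\<lambda>r \<phi>. (r ^ n + inverse r ^ n) / (2 * r) * Re (c * cis (real n * \<phi>))) t \<phi>"
      using pos by eventually_elim (simp add: E_def)
  qed (simp_all add: E_def)
  show "((\<lambda>t. ring_harmonic n c (rcis r t)) has_real_derivative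
      (\<lambda>r \<phi>. ring_mode n r *
         (real n * (- Re c * sin (real n * \<phi>) - Im c * cos (real n * \<phi>)))) r \<phi>) (at \<phi>)"
    unfolding ring_harmonic_rcis[OF \<open>r > 0\<close>]
    using DERIV_cmult[OF E, of "ring_mode n r"] unfolding E_def E'_def .
  show "((\<lambda>r \<phi>. ring_mode n r *
         (real n * (- Re c * sin (real n * \<phi>) - Im c * cos (real n * \<phi>)))) r has_real_derivative
      (\<lambda>r \<phi>. ring_mode n r * (real n * (- real n * Re (c * cis (real n * \<phi>))))) r \<phi>) (at \<phi>)"
    using DERIV_cmult[OF DERIV_cmult[OF E'], of "ring_mode n r" "real n"]
    unfolding E_def E'_def .
  show "1 / r * (\<lambda>r \<phi>. (real n)\<^sup>2 * ring_mode n r / r * Re (c * cis (real n * \<phi>))) r \<phi> +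
     1 / r\<^sup>2 * (\<lambda>r \<phi>. ring_mode n r * (real n * (- real n * Re (c * cis (real n * \<phi>))))) r \<phi> = 0"
    unfolding E_def[symmetric] using \<open>r > 0\<close> by (simp add: field_simps power2_eq_square)
qed

text \<open>A trigonometric polynomial close to \<open>u\<close> on the inner circle is extended
  harmonically by zero outer values. The one-sided maximum principle, applied to both differences,
  carries the error bound into the ring.\<close>

lemma ring_approximation:
  fixes u :: "complex \<Rightarrow> real"
  assumes R: "0 < R" "R < 1"
    and cont: "continuous_on {z. R \<le> cmod z \<and> cmod z \<le> 1} u"
    and harm: "polar_harmonic R u"
    and outer: "\<And>\<theta>. u (rcis 1 \<theta>) = 0"
    and "e > 0"
  shows "\<exists>N c. \<forall>r \<phi>. R \<le> r \<and> r \<le> 1 \<longrightarrow>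
    \<bar>u (rcis r \<phi>) - (\<Sum>n\<le>N. ring_mode n r / ring_mode n R * Re (c n * cis (real n * \<phi>)))\<bar> \<le> e"
proof -
  define K where "K = {z. R \<le> cmod z \<and> cmod z \<le> 1}"
  have "continuous_on (sphere 0 1) (\<lambda>z. u (of_real R * z))"
    using R by (intro continuous_on_compose2[OF cont]) (auto intro!: continuous_intros simp: norm_mult)
  from trig_poly_dense[OF this \<open>e > 0\<close>] obtain N c
    where c: "\<bar>u (rcis R \<theta>) - (\<Sum>n\<le>N. Re (c n * cis (real n * \<theta>)))\<bar> < e" for \<theta>
    unfolding rcis_def by blast
  have nz: "ring_mode n R \<noteq> 0" for n using ring_mode_neg[OF R, of n] by simp
  \<comment> \<open>Dividing by \<open>ring_mode n R\<close> gives \<open>v\<close> the chosen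
    trigonometric polynomial as inner boundary values; on the outer circle every mode
    vanishes.\<close>
  define v where "v z = (\<Sum>n\<le>N. ring_harmonic n (c n / ring_mode n R) z)" for z
  have v_rcis: "v (rcis r \<phi>) = (\<Sum>n\<le>N. ring_mode n r / ring_mode n R * Re (c n * cis (real n * \<phi>)))"
    if "r > 0" for r \<phi>
    unfolding v_def ring_harmonic_rcis[OF that] by (intro sum.cong refl) (simp add: field_simps)
  have v_inner: "v (rcis R \<phi>) = (\<Sum>n\<le>N. Re (c n * cis (real n * \<phi>)))" for \<phi>
    unfolding v_rcis[OF R(1)] using nz by (intro sum.cong refl) simp
  have v_outer: "v (rcis 1 \<phi>) = 0" for \<phi>
    unfolding v_rcis[OF zero_less_one] by simp
  have harm_v: "polar_harmonic R v"
    unfolding v_def[abs_def] using R by (intro polar_harmonic_sum polar_harmonic_ring_harmonic) auto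
  have cont_v: "continuous_on K v"
    unfolding v_def[abs_def] using R
    by (intro continuous_on_sum continuous_on_ring_harmonic) (auto simp: K_def)
  have cont_u: "continuous_on K u" using cont by (simp add: K_def)
  show ?thesis
  proof (intro exI allI impI)
    fix r \<phi> :: real assume r: "R \<le> r \<and> r \<le> 1"
    have "u (rcis r \<phi>) - v (rcis r \<phi>) \<le> e"
    proof (rule polar_harmonic_maximum_principle[OF R, where w = "\<lambda>z. u z - v z"])
      show "continuous_on {z. R \<le> cmod z \<and> cmod z \<le> 1} (\<lambda>z. u z - v z)"
        using cont_u cont_v by (auto simp: K_def intro: continuous_on_diff)
      show "polar_harmonic R (\<lambda>z. u z - v z)"
        using harm harm_v by (intro polar_harmonic_diff)
      fix \<theta>
      show "u (rcis R \<theta>) - v (rcis R \<theta>) \<le> e"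
        using c[of \<theta>] unfolding v_inner by linarith
      show "u (rcis 1 \<theta>) - v (rcis 1 \<theta>) \<le> e"
        using outer v_outer \<open>e > 0\<close> by simp
    qed (use r in auto)
    moreover have "v (rcis r \<phi>) - u (rcis r \<phi>) \<le> e"
    proof (rule polar_harmonic_maximum_principle[OF R, where w = "\<lambda>z. v z - u z"])
      show "continuous_on {z. R \<le> cmod z \<and> cmod z \<le> 1} (\<lambda>z. v z - u z)"
        using cont_u cont_v by (auto simp: K_def intro: continuous_on_diff)
      show "polar_harmonic R (\<lambda>z. v z - u z)"
        using harm harm_v by (intro polar_harmonic_diff)
      fix \<theta>
      show "v (rcis R \<theta>) - u (rcis R \<theta>) \<le> e"
        using c[of \<theta>] unfolding v_inner by linarith
      show "v (rcis 1 \<theta>) - u (rcis 1 \<theta>) \<le> e"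
        using outer v_outer \<open>e > 0\<close> by simp
    qed (use r in auto)
    ultimately have "\<bar>u (rcis r \<phi>) - v (rcis r \<phi>)\<bar> \<le> e" by linarith
    then show "\<bar>u (rcis r \<phi>) -
        (\<Sum>n\<le>N. ring_mode n r / ring_mode n R * Re (c n * cis (real n * \<phi>)))\<bar> \<le> e"
      using v_rcis[of r \<phi>] r R by simp
  qed
qed

section \<open>Fourier coefficients\<close>

text \<open>The Weierstrass M-test makes the partial sums converge uniformly, which permits
  integration term by term.\<close>

lemma integral_sums_uniform:
  fixes f :: "nat \<Rightarrow> real \<Rightarrow> 'a::banach"
  assumes cont: "\<And>n. continuous_on {a..b} (f n)"
    and bound: "\<And>n x. x \<in> {a..b} \<Longrightarrow> norm (f n x) \<le> M n"
    and M: "summable M"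
  shows "(\<lambda>n. integral {a..b} (f n)) sums integral {a..b} (\<lambda>x. \<Sum>n. f n x)"
proof -
  have "uniform_limit {a..b} (\<lambda>N x. \<Sum>n<N. f n x) (\<lambda>x. \<Sum>n. f n x) sequentially"
    by (rule Weierstrass_m_test[OF bound M])
  then obtain I J where IJ: "\<And>N. ((\<lambda>x. \<Sum>n<N. f n x) has_integral I N) {a..b}"
      "((\<lambda>x. \<Sum>n. f n x) has_integral J) {a..b}" "I \<longlonglongrightarrow> J"
    by (rule uniform_limit_integral) (auto intro!: continuous_on_sum cont)
  have "I = (\<lambda>N. \<Sum>n<N. integral {a..b} (f n))"
    using integral_unique[OF IJ(1)]
    by (simp add: fun_eq_iff integral_sum integrable_continuous_real cont)
  then show ?thesis
    using IJ(3) integral_unique[OF IJ(2)] by (simp add: sums_def)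
qed

lemma continuous_on_Icc_abs_bounded:
  fixes f :: "real \<Rightarrow> real"
  assumes "continuous_on {a..b} f"
  shows "\<exists>B. \<forall>x\<in>{a..b}. \<bar>f x\<bar> \<le> B"
proof -
  have "bounded (f ` {a..b})"
    using assms by (intro compact_imp_bounded compact_continuous_image) auto
  then show ?thesis
    unfolding bounded_iff real_norm_def by blast
qed

text \<open>For \<open>k \<noteq> 0\<close> the antiderivative
  \<open>- \<i> / k * cis (k * \<theta>)\<close> takes the same value at both ends of the
  period.\<close>

lemma has_integral_cis:
  "((\<lambda>\<theta>. cis (of_int k * \<theta>)) has_integral (if k = 0 then 2 * pi else 0)) {0..2 * pi}"
proof (cases "k = 0")
  case True
  then show ?thesis using has_integral_const_real[of "1::complex" 0 "2 * pi"]
    by (simp add: scaleR_conv_of_real)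
next
  case False
  have "((\<lambda>\<theta>. cis (of_int k * \<theta>)) has_integral
      (- \<i> / of_int k * cis (of_int k * (2 * pi)) - - \<i> / of_int k * cis (of_int k * 0))) {0..2 * pi}"
  proof (rule fundamental_theorem_of_calculus)
    fix \<theta> :: real
    have cis_eq: "of_real (cos x) + \<i> * of_real (sin x) = cis x" for x
      by (simp add: complex_eq_iff)
    have deriv_eq: "- \<i> / of_int k * (of_real (- of_int k * sin (of_int k * \<theta>))
        + \<i> * of_real (of_int k * cos (of_int k * \<theta>))) = cis (of_int k * \<theta>)"
      using False by (simp add: field_simps) (simp add: complex_eq_iff)
    have "((\<lambda>\<theta>. cos (of_int k * \<theta>)) has_real_derivative - of_int k * sin (of_int k * \<theta>)) (at \<theta> within {0..2 * pi})"
      "((\<lambda>\<theta>. sin (of_int k * \<theta>)) has_real_derivative of_int k * cos (of_int k * \<theta>)) (at \<theta> within {0..2 * pi})"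
      by (auto intro!: derivative_eq_intros)
    then have "((\<lambda>\<theta>. of_real (cos (of_int k * \<theta>)) + \<i> * of_real (sin (of_int k * \<theta>))) has_vector_derivative
      (of_real (- of_int k * sin (of_int k * \<theta>)) + \<i> * of_real (of_int k * cos (of_int k * \<theta>)))) (at \<theta> within {0..2 * pi})"
      by (intro has_vector_derivative_add has_vector_derivative_mult_right has_vector_derivative_of_real)
         (simp_all add: has_real_derivative_iff_has_vector_derivative)
    from has_vector_derivative_mult_right[OF this, of "- \<i> / of_int k"]
    show "((\<lambda>\<theta>. - \<i> / of_int k * cis (of_int k * \<theta>)) has_vector_derivative cis (of_int k * \<theta>))
        (at \<theta> within {0..2 * pi})"
      unfolding cis_eq deriv_eq .
  qed simp
  moreover have "cis (of_int k * (2 * pi)) = 1"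
    by (simp add: complex_eq_iff mult.commute[of _ "2 * pi"] cos_int_2pin sin_int_2pin)
  ultimately show ?thesis using False by simp
qed

text \<open>The doubled weight for \<open>n > 0\<close> makes \<open>Re (fourier_coeff f n * cis (n * \<theta>))\<close> the
  contribution of both frequencies \<open>n\<close> and \<open>-n\<close> to the Fourier series of the real function \<open>f\<close>.\<close>

definition mode_weight :: "nat \<Rightarrow> real" where
  "mode_weight n = (if n = 0 then 2 * pi else pi)"

definition fourier_coeff :: "(real \<Rightarrow> real) \<Rightarrow> nat \<Rightarrow> complex" where
  "fourier_coeff f n =
     integral {0..2 * pi} (\<lambda>\<theta>. of_real (f \<theta>) * cis (- (real n * \<theta>))) / of_real (mode_weight n)"

lemma mode_weight_pos: "mode_weight n > 0" "mode_weight n \<ge> pi"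
  by (auto simp: mode_weight_def)

lemma fourier_integrand_continuous:
  assumes "continuous_on {0..2 * pi} f"
  shows "continuous_on {0..2 * pi} (\<lambda>\<theta>. of_real (f \<theta>) * cis (- (real n * \<theta>)))"
  using assms by (auto intro!: continuous_intros)

lemma fourier_coeff_diff:
  assumes "continuous_on {0..2 * pi} f" "continuous_on {0..2 * pi} g"
  shows "fourier_coeff (\<lambda>\<theta>. f \<theta> - g \<theta>) n = fourier_coeff f n - fourier_coeff g n"
proof -
  have "integral {0..2 * pi} (\<lambda>\<theta>. of_real (f \<theta> - g \<theta>) * cis (- (real n * \<theta>)))
      = integral {0..2 * pi} (\<lambda>\<theta>. of_real (f \<theta>) * cis (- (real n * \<theta>)) - of_real (g \<theta>) * cis (- (real n * \<theta>)))"
    by (intro integral_cong) (simp add: algebra_simps)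
  also have "\<dots> = integral {0..2 * pi} (\<lambda>\<theta>. of_real (f \<theta>) * cis (- (real n * \<theta>)))
      - integral {0..2 * pi} (\<lambda>\<theta>. of_real (g \<theta>) * cis (- (real n * \<theta>)))"
    by (intro integral_diff integrable_continuous_real fourier_integrand_continuous assms)
  finally show ?thesis by (simp add: fourier_coeff_def diff_divide_distrib)
qed

text \<open>The factor 2 is the ratio of the length of the period to the smaller weight
  \<open>pi\<close>, which occurs for \<open>n > 0\<close>.\<close>

lemma norm_fourier_coeff_le:
  assumes cont: "continuous_on {0..2 * pi} f"
    and bound: "\<And>\<theta>. \<theta> \<in> {0..2 * pi} \<Longrightarrow> \<bar>f \<theta>\<bar> \<le> B"
  shows "norm (fourier_coeff f n) \<le> 2 * B"
proof -
  have "B \<ge> 0" using bound[of 0] by simp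
  have "norm (integral {0..2 * pi} (\<lambda>\<theta>. of_real (f \<theta>) * cis (- (real n * \<theta>)))) \<le> B * (2 * pi - 0)"
    by (rule integral_bound) (auto intro!: fourier_integrand_continuous cont simp: norm_mult bound)
  then have "norm (fourier_coeff f n) \<le> B * (2 * pi) / mode_weight n"
    using mode_weight_pos(1)[of n] by (simp add: fourier_coeff_def norm_divide divide_right_mono)
  also have "\<dots> \<le> B * (2 * pi) / pi"
    using mode_weight_pos[of n] \<open>B \<ge> 0\<close> by (intro divide_left_mono) auto
  finally show ?thesis by simp
qed

lemma abs_Re_mult_cis_le: "\<bar>Re (z * cis x)\<bar> \<le> norm z"
  by (metis abs_Re_le_cmod mult.right_neutral norm_cis norm_mult)

text \<open>Writing the real part as half of \<open>w + cnj w\<close> produces the frequencies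
  \<open>m - n\<close> and \<open>- m - n\<close>. The second one survives only for
  \<open>m = n = 0\<close>, where it cancels the imaginary part of \<open>c\<close>.\<close>

lemma integral_trig_mode:
  "((\<lambda>\<theta>. of_real (Re (c * cis (real m * \<theta>))) * cis (- (real n * \<theta>))) has_integral
     (if m = n then if n = 0 then of_real (2 * pi * Re c) else of_real pi * c else 0)) {0..2 * pi}"
proof -
  have eq: "of_real (Re (c * cis (real m * \<theta>))) * cis (- (real n * \<theta>))
     = c / 2 * cis (of_int (int m - int n) * \<theta>) + cnj c / 2 * cis (of_int (- int m - int n) * \<theta>)" for \<theta>
  proof -
    have "of_real (Re (c * cis (real m * \<theta>))) = (c * cis (real m * \<theta>) + cnj c * cis (- (real m * \<theta>))) / 2"
      using complex_add_cnj[of "c * cis (real m * \<theta>)"] by (simp add: cis_cnj)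
    then have "of_real (Re (c * cis (real m * \<theta>))) * cis (- (real n * \<theta>))
       = c / 2 * (cis (real m * \<theta>) * cis (- (real n * \<theta>)))
         + cnj c / 2 * (cis (- (real m * \<theta>)) * cis (- (real n * \<theta>)))"
      by (simp add: algebra_simps add_divide_distrib)
    then show ?thesis by (simp add: cis_mult algebra_simps)
  qed
  show ?thesis
    unfolding eq
  proof (rule has_integral_eq_rhs)
    show "((\<lambda>\<theta>. c / 2 * cis (of_int (int m - int n) * \<theta>) + cnj c / 2 * cis (of_int (- int m - int n) * \<theta>))
      has_integral (c / 2 * (if int m - int n = 0 then 2 * pi else 0)
        + cnj c / 2 * (if - int m - int n = 0 then 2 * pi else 0))) {0..2 * pi}"
      by (intro has_integral_add has_integral_mult_right has_integral_cis)
    show "(if m = n then if n = 0 then of_real (2 * pi * Re c) else of_real pi * c else 0)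
        = c / 2 * (if int m - int n = 0 then 2 * pi else 0)
        + cnj c / 2 * (if - int m - int n = 0 then 2 * pi else 0)"
      by (auto simp: complex_eq_iff)
  qed
qed

text \<open>Absolute summability permits termwise integration, and orthogonality leaves one term.
  The imaginary part of \<open>c 0\<close> is invisible in the series and cannot be
  recovered.\<close>

lemma fourier_coeff_series:
  assumes "summable (\<lambda>n. norm (c n))"
    and f: "\<And>\<theta>. (\<lambda>n. Re (c n * cis (real n * \<theta>))) sums f \<theta>"
  shows "fourier_coeff f n = (if n = 0 then of_real (Re (c 0)) else c n)"
proof -
  let ?g = "\<lambda>m \<theta>. of_real (Re (c m * cis (real m * \<theta>))) * cis (- (real n * \<theta>))"
  have int: "integral {0..2 * pi} (?g m)
      = (if m = n then if n = 0 then of_real (2 * pi * Re (c m)) else of_real pi * c m else 0)" for m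
    by (rule integral_unique[OF integral_trig_mode])
  have "(\<lambda>m. integral {0..2 * pi} (?g m)) sums integral {0..2 * pi} (\<lambda>\<theta>. \<Sum>m. ?g m \<theta>)"
  proof (rule integral_sums_uniform[OF _ _ assms(1)])
    fix m \<theta>
    show "norm (?g m \<theta>) \<le> norm (c m)"
      unfolding norm_mult norm_of_real norm_cis mult_1_right by (rule abs_Re_mult_cis_le)
  qed (auto intro!: continuous_intros)
  moreover have "(\<Sum>m. ?g m \<theta>) = of_real (f \<theta>) * cis (- (real n * \<theta>))" for \<theta>
    using sums_mult2[OF sums_of_real[OF f[of \<theta>]], of "cis (- (real n * \<theta>))"]
    by (simp add: sums_iff)
  then have "integral {0..2 * pi} (\<lambda>\<theta>. \<Sum>m. ?g m \<theta>)
      = integral {0..2 * pi} (\<lambda>\<theta>. of_real (f \<theta>) * cis (- (real n * \<theta>)))"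
    by (intro integral_cong)
  ultimately have eq: "(if n = 0 then of_real (2 * pi * Re (c n)) else of_real pi * c n)
      = integral {0..2 * pi} (\<lambda>\<theta>. of_real (f \<theta>) * cis (- (real n * \<theta>)))"
    unfolding int
    using sums_unique2 sums_single[of n "\<lambda>m. if n = 0 then of_real (2 * pi * Re (c m)) else of_real pi * c m"]
    by fastforce
  then show ?thesis
    unfolding fourier_coeff_def mode_weight_def by (auto simp flip: eq)
qed

section \<open>Expansion of the solution\<close>

text \<open>An approximation within \<open>e\<close> on the inner circle changes each coefficient by
  at most \<open>2 * e\<close>. Since the radial ratios have the summable majorant \<open>W\<close>,
  the candidate sum \<open>S\<close> and the approximation differ by a multiple of \<open>e\<close>,
  and \<open>e\<close> is arbitrary.\<close>

lemma ring_fourier_expansion: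
  fixes u :: "complex \<Rightarrow> real"
  assumes R: "0 < R" "R < 1"
    and cont: "continuous_on {z. R \<le> cmod z \<and> cmod z \<le> 1} u"
    and harm: "polar_harmonic R u"
    and outer: "\<And>\<theta>. u (rcis 1 \<theta>) = 0"
    and r: "R < r" "r \<le> 1"
  shows "(\<lambda>n. ring_mode n r / ring_mode n R *
            Re (fourier_coeff (\<lambda>\<theta>. u (rcis R \<theta>)) n * cis (real n * \<phi>))) sums u (rcis r \<phi>)"
proof -
  define f where "f \<theta> = u (rcis R \<theta>)" for \<theta>
  define G where "G n = ring_mode n r / ring_mode n R" for n
  have cont_f: "continuous_on {0..2 * pi} f"
    unfolding f_def using R
    by (intro continuous_on_compose2[OF cont]) (auto intro!: continuous_intros simp: rcis_def norm_mult)
  obtain B where B: "\<And>\<theta>. \<theta> \<in> {0..2 * pi} \<Longrightarrow> \<bar>f \<theta>\<bar> \<le> B"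
    using continuous_on_Icc_abs_bounded[OF cont_f] by blast
  define W where "W n = inverse r ^ Suc n / \<bar>ring_mode n R\<bar>" for n
  have W: "summable W" unfolding W_def by (rule summable_ring_mode_ratio[OF R(1) r])
  have GW: "\<bar>G n\<bar> \<le> W n" for n
    unfolding G_def W_def abs_divide using R r by (intro divide_right_mono ring_mode_abs_le) auto
  have summ: "summable (\<lambda>n. G n * Re (fourier_coeff f n * cis (real n * \<phi>)))"
  proof (rule summable_comparison_test')
    show "summable (\<lambda>n. W n * (2 * B))" by (intro summable_mult2 W)
    show "norm (G n * Re (fourier_coeff f n * cis (real n * \<phi>))) \<le> W n * (2 * B)" if "n \<ge> 0" for n
      unfolding real_norm_def abs_mult
      by (intro mult_mono GW order.trans[OF abs_Re_mult_cis_le] norm_fourier_coeff_le cont_f B)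
         (use GW[of n] in auto)
  qed
  define S where "S = (\<Sum>n. G n * Re (fourier_coeff f n * cis (real n * \<phi>)))"
  have close: "\<bar>u (rcis r \<phi>) - S\<bar> \<le> e * (1 + 2 * suminf W)" if "e > 0" for e
  proof -
    obtain N c where c: "\<forall>r \<phi>. R \<le> r \<and> r \<le> 1 \<longrightarrow>
        \<bar>u (rcis r \<phi>) - (\<Sum>n\<le>N. ring_mode n r / ring_mode n R * Re (c n * cis (real n * \<phi>)))\<bar> \<le> e"
      using ring_approximation[OF R cont harm outer \<open>e > 0\<close>] by (elim exE)
    \<comment> \<open>Padding with zeros turns the finite sum into a series that can be subtracted
      term by term.\<close>
    define d where "d n = (if n \<le> N then c n else 0)" for n
    define p where "p \<theta> = (\<Sum>n\<le>N. Re (c n * cis (real n * \<theta>)))" for \<theta>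
    have fin: "(\<lambda>n. g n * Re (d n * cis (real n * \<theta>))) sums (\<Sum>n\<le>N. g n * Re (c n * cis (real n * \<theta>)))"
      for \<theta> and g :: "nat \<Rightarrow> real"
      using sums_finite[of "{..N}" "\<lambda>n. g n * Re (d n * cis (real n * \<theta>))"] by (simp add: d_def)
    have cont_p: "continuous_on {0..2 * pi} p"
      unfolding p_def by (auto intro!: continuous_intros)
    have fp: "\<bar>f \<theta> - p \<theta>\<bar> \<le> e" for \<theta>
    proof -
      have "ring_mode n R / ring_mode n R = 1" for n using ring_mode_neg[OF R, of n] by simp
      then show ?thesis using c[rule_format, of R \<theta>] R by (simp add: f_def p_def)
    qed
    \<comment> \<open>Only real parts are compared, because the Fourier coefficient of
      \<open>p\<close> at 0 loses the imaginary part of \<open>d 0\<close>.\<close>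
    have Re_p: "Re (fourier_coeff p n * cis (real n * \<phi>)) = Re (d n * cis (real n * \<phi>))" for n
    proof -
      have "summable (\<lambda>n. norm (d n))" by (rule summable_finite[of "{..N}"]) (auto simp: d_def)
      moreover have "(\<lambda>n. Re (d n * cis (real n * \<theta>))) sums p \<theta>" for \<theta>
        using fin[of "\<lambda>_. 1"] by (simp add: p_def)
      ultimately show ?thesis
        using fourier_coeff_series[of d p n] by auto
    qed
    have diff: "\<bar>Re (fourier_coeff f n * cis (real n * \<phi>)) - Re (d n * cis (real n * \<phi>))\<bar> \<le> 2 * e" for n
    proof -
      have "\<bar>Re (fourier_coeff f n * cis (real n * \<phi>)) - Re (d n * cis (real n * \<phi>))\<bar>
          = \<bar>Re (fourier_coeff (\<lambda>\<theta>. f \<theta> - p \<theta>) n * cis (real n * \<phi>))\<bar>"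
        unfolding fourier_coeff_diff[OF cont_f cont_p] Re_p[symmetric] left_diff_distrib by simp
      also have "\<dots> \<le> norm (fourier_coeff (\<lambda>\<theta>. f \<theta> - p \<theta>) n)" by (rule abs_Re_mult_cis_le)
      also have "\<dots> \<le> 2 * e"
        by (intro norm_fourier_coeff_le continuous_on_diff cont_f cont_p fp)
      finally show ?thesis .
    qed
    define v where "v = (\<Sum>n\<le>N. G n * Re (c n * cis (real n * \<phi>)))"
    have sums_diff: "(\<lambda>n. G n * Re (fourier_coeff f n * cis (real n * \<phi>))
        - G n * Re (d n * cis (real n * \<phi>))) sums (S - v)"
      unfolding S_def v_def by (intro sums_diff summable_sums summ fin)
    have term_le: "norm (G n * Re (fourier_coeff f n * cis (real n * \<phi>))
        - G n * Re (d n * cis (real n * \<phi>))) \<le> W n * (2 * e)" for n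
      unfolding right_diff_distrib[symmetric] real_norm_def abs_mult
      by (intro mult_mono GW diff) (use GW[of n] in auto)
    have "\<bar>S - v\<bar> \<le> suminf W * (2 * e)"
      using norm_suminf_le[of _ "\<lambda>n. W n * (2 * e)", OF term_le summable_mult2[OF W]] sums_diff
        suminf_mult2[OF W, of "2 * e"] by (simp add: sums_iff)
    moreover have "\<bar>u (rcis r \<phi>) - v\<bar> \<le> e"
      using c[rule_format, of r \<phi>] r by (simp add: v_def G_def)
    ultimately show ?thesis by (simp add: algebra_simps)
  qed
  have "suminf W \<ge> 0" using GW by (intro suminf_nonneg W) (smt (verit))
  \<comment> \<open>Rescaling \<open>e\<close> absorbs the constant \<open>1 + 2 * suminf W\<close>,
    which does not depend on the approximation.\<close>
  have "\<bar>u (rcis r \<phi>) - S\<bar> \<le> 0 + e" if "e > 0" for e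
    using close[of "e / (1 + 2 * suminf W)"] that \<open>suminf W \<ge> 0\<close> by (simp add: divide_simps)
  then have "\<bar>u (rcis r \<phi>) - S\<bar> \<le> 0" by (rule field_le_epsilon)
  then have "u (rcis r \<phi>) = S" by simp
  then show ?thesis
    using summable_sums[OF summ, folded S_def] unfolding G_def f_def[abs_def] by (simp only:)
qed

text \<open>With \<open>s < 1\<close> this is the majorant for termwise differentiation up to the
  outer circle; with \<open>s = 1\<close> it gives absolute summability of the coefficients.\<close>

lemma summable_ring_coeff:
  assumes "0 < R" "R < s" "s \<le> 1" and cont: "continuous_on {0..2 * pi} f"
  shows "summable (\<lambda>n. inverse s ^ Suc n * norm (fourier_coeff f n / of_real (ring_mode n R)))"
proof -
  obtain B where B: "\<And>\<theta>. \<theta> \<in> {0..2 * pi} \<Longrightarrow> \<bar>f \<theta>\<bar> \<le> B"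
    using continuous_on_Icc_abs_bounded[OF cont] by blast
  show ?thesis
  proof (rule summable_comparison_test')
    show "summable (\<lambda>n. 2 * B * (inverse s ^ Suc n / \<bar>ring_mode n R\<bar>))"
      by (intro summable_mult summable_ring_mode_ratio assms)
    fix n :: nat
    have "norm (inverse s ^ Suc n * norm (fourier_coeff f n / of_real (ring_mode n R)))
        = norm (fourier_coeff f n) * (inverse s ^ Suc n / \<bar>ring_mode n R\<bar>)"
      using assms by (simp add: norm_divide)
    also have "\<dots> \<le> 2 * B * (inverse s ^ Suc n / \<bar>ring_mode n R\<bar>)"
      using assms by (intro mult_right_mono norm_fourier_coeff_le cont B) auto
    finally show "norm (inverse s ^ Suc n * norm (fourier_coeff f n / of_real (ring_mode n R)))
        \<le> 2 * B * (inverse s ^ Suc n / \<bar>ring_mode n R\<bar>)" .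
  qed
qed

text \<open>The differentiated series converges uniformly on \<open>{s..1}\<close> by the M-test,
  and at \<open>t = 1\<close> every radial factor has slope 1, so only the angular parts
  remain.\<close>

lemma normal_derivative_expansion:
  fixes g h :: "real \<Rightarrow> real" and a :: "nat \<Rightarrow> complex"
  assumes s: "0 < s" "s < 1"
    and a: "summable (\<lambda>n. inverse s ^ Suc n * norm (a n))"
    and g: "\<And>t. s \<le> t \<Longrightarrow> t \<le> 1 \<Longrightarrow>
      (\<lambda>n. ring_mode n t * Re (a n * cis (real n * \<theta>))) sums g t"
    and deriv: "(g has_real_derivative D) (at_left 1)"
  shows "(\<lambda>n. Re (a n * cis (real n * \<theta>))) sums D"
proof -
  define \<rho> where "\<rho> n = Re (a n * cis (real n * \<theta>))" for n
  define f' where "f' n t = (t ^ n + inverse t ^ n) / (2 * t) * \<rho> n" for n t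
  define g' where "g' t = (\<Sum>n. f' n t)" for t
  have f'_bound: "norm (f' n t) \<le> inverse s ^ Suc n * norm (a n)" if "t \<in> {s..1}" for n t
  proof -
    have t: "0 < t" "t \<le> 1" "s \<le> t" using that s by auto
    have "inverse t ^ Suc n \<le> inverse s ^ Suc n"
      using t s by (intro power_mono le_imp_inverse_le) auto
    then show ?thesis
      unfolding f'_def \<rho>_def norm_mult real_norm_def abs_mult
      using s by (intro mult_mono abs_Re_mult_cis_le order.trans[OF ring_mode_deriv_abs_le[OF t(1,2)]]) auto
  qed
  have "uniform_limit {s..1} (\<lambda>N t. \<Sum>n<N. f' n t) g' sequentially"
    unfolding g'_def by (rule Weierstrass_m_test[OF f'_bound a])
  moreover have "((\<lambda>t. ring_mode n t * \<rho> n) has_real_derivative f' n t) (at t within {s..1})"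
    if "t \<in> {s..1}" for n t
    using that s unfolding f'_def by (intro DERIV_cmult_right ring_mode_has_derivative) auto
  \<comment> \<open>The base point 1 makes convergence of the undifferentiated series trivial, since
    all its terms vanish there.\<close>
  ultimately obtain G where "\<forall>t\<in>{s..1}. (\<lambda>n. ring_mode n t * \<rho> n) sums G t \<and>
      (G has_real_derivative g' t) (at t within {s..1})"
    using has_field_derivative_series[of "{s..1}" "\<lambda>n t. ring_mode n t * \<rho> n" f' g' 1] s by auto
  then have G: "(\<lambda>n. ring_mode n t * \<rho> n) sums G t"
      "(G has_real_derivative g' t) (at t within {s..1})" if "t \<in> {s..1}" for t
    using that by auto
  have "G t = g t" if "t \<in> {s..1}" for t
    using G[OF that] g[of t] that by (auto simp: \<rho>_def dest: sums_unique2)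
  then have "(g has_real_derivative g' 1) (at 1 within {s..1})"
    using G[of 1] s has_field_derivative_transform_within[of G "g' 1" 1 "{s..1}" 1 g] by auto
  \<comment> \<open>At the right endpoint the derivative within the interval is the left derivative,
    which is unique and hence equals \<open>D\<close>.\<close>
  then have "(g has_real_derivative g' 1) (at_left 1)"
    using s by (simp add: at_within_Icc_at_left)
  then have "g' 1 = D"
    using deriv trivial_limit_at_left_real by (rule has_field_derivative_unique)
  moreover have "summable (\<lambda>n. f' n 1)"
    using f'_bound[of 1] s by (intro summable_comparison_test'[OF a]) auto
  ultimately show ?thesis
    unfolding g'_def f'_def \<rho>_def by (auto simp: sums_iff)
qed

section \<open>The integral formula\<close>

text \<open>Real part of the exponential series at the complex number
  \<open>\<mu> * cis x\<close>.\<close>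

lemma exp_cis_kernel_sums:
  "(\<lambda>m. \<mu> ^ m / fact m * Re (cis (real m * x))) sums (exp (\<mu> * cos x) * cos (\<mu> * sin x))"
proof -
  have "(\<lambda>m. Re ((of_real \<mu> * cis x) ^ m /\<^sub>R fact m)) sums Re (exp (of_real \<mu> * cis x))"
    by (intro sums_Re exp_converges)
  moreover have "Re ((of_real \<mu> * cis x) ^ m /\<^sub>R fact m) = \<mu> ^ m / fact m * Re (cis (real m * x))" for m
    unfolding power_mult_distrib Complex.DeMoivre by (simp flip: of_real_power add: field_simps)
  moreover have "Re (exp (of_real \<mu> * cis x)) = exp (\<mu> * cos x) * cos (\<mu> * sin x)"
    by (simp add: Re_exp)
  ultimately show ?thesis by simp
qed

text \<open>The kernel series is integrated against \<open>h\<close> term by term; since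
  \<open>cis (m * (\<phi> - \<psi>))\<close> factors, each term is a Fourier coefficient of
  \<open>h\<close> with its normalization undone.\<close>

lemma inner_integral_sums:
  assumes cont: "continuous_on {0..2 * pi} h"
  shows "(\<lambda>m. \<mu> ^ m / fact m * (mode_weight m * Re (fourier_coeff h m * cis (real m * \<phi>)))) sums
    integral {0..2 * pi} (\<lambda>\<psi>. exp (\<mu> * cos (\<phi> - \<psi>)) * cos (\<mu> * sin (\<phi> - \<psi>)) * h \<psi>)"
proof -
  obtain B where B: "\<And>\<theta>. \<theta> \<in> {0..2 * pi} \<Longrightarrow> \<bar>h \<theta>\<bar> \<le> B"
    using continuous_on_Icc_abs_bounded[OF cont] by blast
  define g where "g m \<psi> = \<mu> ^ m / fact m * Re (cis (real m * (\<phi> - \<psi>))) * h \<psi>" for m \<psi>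
  have g_eq: "g m = (\<lambda>\<psi>. \<mu> ^ m / fact m * Re (of_real (h \<psi>) * cis (- (real m * \<psi>)) * cis (real m * \<phi>)))" for m
  proof
    fix \<psi>
    have "cis (real m * (\<phi> - \<psi>)) = cis (- (real m * \<psi>)) * cis (real m * \<phi>)"
      by (simp add: cis_mult algebra_simps)
    then have "of_real (h \<psi>) * cis (- (real m * \<psi>)) * cis (real m * \<phi>)
        = of_real (h \<psi>) * cis (real m * (\<phi> - \<psi>))" by (simp only: mult.assoc)
    then show "g m \<psi> = \<mu> ^ m / fact m * Re (of_real (h \<psi>) * cis (- (real m * \<psi>)) * cis (real m * \<phi>))"
      by (simp only: g_def) simp
  qed
  have "integral {0..2 * pi} (g m)
      = \<mu> ^ m / fact m * (mode_weight m * Re (fourier_coeff h m * cis (real m * \<phi>)))" for m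
  proof -
    \<comment> \<open>Rotation, real part and scaling form one real-linear map, which commutes with
      the integral.\<close>
    have lin: "bounded_linear (\<lambda>z. \<mu> ^ m / fact m * Re (z * cis (real m * \<phi>)))"
      by (intro bounded_linear_compose[OF bounded_linear_mult_right]
          bounded_linear_compose[OF bounded_linear_Re bounded_linear_mult_left])
    have "integral {0..2 * pi} (g m) = \<mu> ^ m / fact m *
        Re (integral {0..2 * pi} (\<lambda>\<psi>. of_real (h \<psi>) * cis (- (real m * \<psi>))) * cis (real m * \<phi>))"
      unfolding g_eq
      using integral_linear[OF integrable_continuous_real[OF fourier_integrand_continuous[OF cont]] lin]
      by (simp only: o_def)
    also have "integral {0..2 * pi} (\<lambda>\<psi>. of_real (h \<psi>) * cis (- (real m * \<psi>)))
        = of_real (mode_weight m) * fourier_coeff h m"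
      using mode_weight_pos(1)[of m] by (simp add: fourier_coeff_def)
    finally show ?thesis by (simp add: mult.assoc)
  qed
  moreover have "(\<lambda>m. integral {0..2 * pi} (g m)) sums integral {0..2 * pi} (\<lambda>\<psi>. \<Sum>m. g m \<psi>)"
  proof (rule integral_sums_uniform)
    show "summable (\<lambda>m. \<bar>\<mu>\<bar> ^ m / fact m * B)"
      using summable_exp[of "\<bar>\<mu>\<bar>"] by (intro summable_mult2) (simp add: field_simps)
    show "continuous_on {0..2 * pi} (g m)" for m
      unfolding g_def using cont by (auto intro!: continuous_intros)
    show "norm (g m \<psi>) \<le> \<bar>\<mu>\<bar> ^ m / fact m * B" if "\<psi> \<in> {0..2 * pi}" for m \<psi>
    proof -
      have "norm (g m \<psi>) = \<bar>\<mu>\<bar> ^ m / fact m * (\<bar>cos (real m * (\<phi> - \<psi>))\<bar> * \<bar>h \<psi>\<bar>)"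
        by (simp add: g_def abs_mult power_abs)
      also have "\<dots> \<le> \<bar>\<mu>\<bar> ^ m / fact m * (1 * B)"
        using B[OF that] by (intro mult_left_mono mult_mono) auto
      finally show ?thesis by simp
    qed
  qed
  moreover have "(\<Sum>m. g m \<psi>) = exp (\<mu> * cos (\<phi> - \<psi>)) * cos (\<mu> * sin (\<phi> - \<psi>)) * h \<psi>" for \<psi>
    unfolding g_def using sums_mult2[OF exp_cis_kernel_sums, of _ _ "h \<psi>"] by (rule sums_unique[symmetric])
  ultimately show ?thesis by simp
qed

section \<open>Radial integrals of Frullani type\<close>

definition radial_kernel :: "real \<Rightarrow> nat \<Rightarrow> real \<Rightarrow> real" where
  "radial_kernel r n \<mu> = indicator {0<..} \<mu> * (1 / \<mu> * (exp (- \<mu> * r) - exp (- \<mu> / r)) * (\<mu> ^ n / fact n))"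

text \<open>The bracket is reversed relative to \<open>cauchy_kernel_integrand\<close> precisely to
  obtain this sign, which allows nonnegative integrals and makes the absolute integrals
  explicit.\<close>

lemma radial_kernel_nonneg:
  assumes "0 < r" "r < 1"
  shows "radial_kernel r n \<mu> \<ge> 0"
proof (cases "\<mu> > 0")
  case True
  have "r * r < 1 * 1" using assms by (intro mult_strict_mono) auto
  then have "r \<le> 1 / r" using assms by (simp add: field_simps)
  then have "- \<mu> / r \<le> - \<mu> * r" using True mult_left_mono[of r "1 / r" \<mu>] by simp
  then show ?thesis using True by (simp add: radial_kernel_def)
qed (simp add: radial_kernel_def)

lemma borel_measurable_radial_kernel [measurable]: "radial_kernel r n \<in> borel_measurable borel"
  unfolding radial_kernel_def[abs_def] by measurable

text \<open>The Gamma integral: up to the factor \<open>inverse t ^ Suc n\<close> the integrand is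
  the Erlang density, whose total mass is its moment of order 0.\<close>

lemma nn_integral_power_exp:
  assumes "0 < t"
  shows "(\<integral>\<^sup>+ \<mu>. ennreal (indicator {0<..} \<mu> * (\<mu> ^ n / fact n * exp (- (t * \<mu>)))) \<partial>lborel)
    = ennreal (inverse t ^ Suc n)"
proof -
  have "(\<integral>\<^sup>+ \<mu>. ennreal (indicator {0<..} \<mu> * (\<mu> ^ n / fact n * exp (- (t * \<mu>)))) \<partial>lborel)
      = (\<integral>\<^sup>+ \<mu>. ennreal (inverse t ^ Suc n) * ennreal (erlang_density n t \<mu>) \<partial>lborel)"
  \<comment> \<open>The point 0 is excluded because the density does not vanish there when
    \<open>n = 0\<close>, whereas the indicator does.\<close>
  proof (intro nn_integral_cong_AE eventually_mono[OF AE_lborel_singleton[of 0]])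
    fix \<mu> :: real assume "\<mu> \<noteq> 0"
    then have "indicator {0<..} \<mu> * (\<mu> ^ n / fact n * exp (- (t * \<mu>)))
        = inverse t ^ Suc n * erlang_density n t \<mu>"
      using assms by (simp add: erlang_density_def indicator_def field_simps)
    then show "ennreal (indicator {0<..} \<mu> * (\<mu> ^ n / fact n * exp (- (t * \<mu>))))
        = ennreal (inverse t ^ Suc n) * ennreal (erlang_density n t \<mu>)"
      using assms by (simp add: ennreal_mult)
  qed
  also have "\<dots> = ennreal (inverse t ^ Suc n) * (\<integral>\<^sup>+ \<mu>. ennreal (erlang_density n t \<mu>) \<partial>lborel)"
    by (rule nn_integral_cmult) simp
  also have "(\<integral>\<^sup>+ \<mu>. ennreal (erlang_density n t \<mu>) \<partial>lborel) = 1"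
    using nn_integral_erlang_ith_moment[OF assms, of n 0] by simp
  finally show ?thesis by simp
qed

text \<open>The endpoints are reciprocal, so the difference of the antiderivative \<open>H\<close>
  reproduces the antisymmetric combination in \<open>ring_mode\<close>.\<close>

lemma has_integral_inverse_power:
  assumes "0 < r" "r < 1"
  shows "((\<lambda>t. inverse t ^ Suc n) has_integral - 2 * ring_mode n r) {r..1 / r}"
proof -
  define H where "H t = (if n = 0 then ln t else - (inverse t ^ n) / real n)" for t
  have "r \<le> 1 / r" using assms by (simp add: field_simps) (smt (verit) mult_left_le_one_le)
  moreover have "(H has_vector_derivative inverse t ^ Suc n) (at t within {r..1 / r})" if "t \<in> {r..1 / r}" for t
  proof (cases "n = 0")
    case True
    then have "H = ln" by (simp add: fun_eq_iff H_def)
    then show ?thesis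
      using that assms True unfolding has_real_derivative_iff_has_vector_derivative[symmetric]
      by (auto intro!: derivative_eq_intros simp: divide_inverse)
  next
    case False
    then have H: "H = (\<lambda>t. - (inverse t ^ n) / real n)" by (simp add: fun_eq_iff H_def)
    have t: "0 < t" using that assms by auto
    show ?thesis
      unfolding has_real_derivative_iff_has_vector_derivative[symmetric] H
      by (rule DERIV_cong[OF DERIV_cdivide[OF DERIV_minus[OF power_has_derivative_pos(2)[OF t]]]])
         (use t False in \<open>simp add: field_simps\<close>)
  qed
  ultimately have "((\<lambda>t. inverse t ^ Suc n) has_integral H (1 / r) - H r) {r..1 / r}"
    by (rule fundamental_theorem_of_calculus)
  moreover have "H (1 / r) - H r = - 2 * ring_mode n r"
    using assms by (simp add: H_def ring_mode_def ln_div field_simps)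
  ultimately show ?thesis by simp
qed

text \<open>Frullani's trick: the bracket divided by \<open>\<mu>\<close> is the integral of \<open>exp (- \<mu> * t)\<close> over
  \<open>t \<in> {r..1 / r}\<close>, so Tonelli's theorem applies.\<close>

lemma has_bochner_integral_radial_kernel:
  assumes r: "0 < r" "r < 1"
  shows "has_bochner_integral lborel (radial_kernel r n) (- 2 * ring_mode n r)"
proof (rule has_bochner_integral_nn_integral)
  define f where "f t \<mu> = ennreal (indicator {0<..} \<mu> * (\<mu> ^ n / fact n * exp (- (t * \<mu>)))) * indicator {r..1 / r} t"
    for t \<mu> :: real
  have "r \<le> 1 / r" using r by (simp add: field_simps) (smt (verit) mult_left_le_one_le)
  have inner: "ennreal (radial_kernel r n \<mu>) = (\<integral>\<^sup>+ t. f t \<mu> \<partial>lborel)" for \<mu>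
  proof (cases "\<mu> > 0")
    case True
    have "((\<lambda>t. \<mu> ^ n / fact n * exp (- (t * \<mu>))) has_integral
        (- (\<mu> ^ n / fact n) / \<mu> * exp (- (1 / r * \<mu>)) - - (\<mu> ^ n / fact n) / \<mu> * exp (- (r * \<mu>)))) {r..1 / r}"
      using True by (intro fundamental_theorem_of_calculus \<open>r \<le> 1 / r\<close>)
        (auto intro!: derivative_eq_intros simp flip: has_real_derivative_iff_has_vector_derivative)
    from nn_integral_has_integral_lebesgue'[OF _ this]
    have "(\<integral>\<^sup>+ t. f t \<mu> \<partial>lborel) = ennreal
        (- (\<mu> ^ n / fact n) / \<mu> * exp (- (1 / r * \<mu>)) - - (\<mu> ^ n / fact n) / \<mu> * exp (- (r * \<mu>)))"
      using True by (simp add: f_def)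
    also have "- (\<mu> ^ n / fact n) / \<mu> * exp (- (1 / r * \<mu>)) - - (\<mu> ^ n / fact n) / \<mu> * exp (- (r * \<mu>))
        = radial_kernel r n \<mu>"
      using True by (simp add: radial_kernel_def algebra_simps diff_divide_distrib)
    finally show ?thesis by simp
  qed (simp add: radial_kernel_def f_def)
  have "(\<integral>\<^sup>+ \<mu>. ennreal (radial_kernel r n \<mu>) \<partial>lborel) = (\<integral>\<^sup>+ \<mu>. \<integral>\<^sup>+ t. f t \<mu> \<partial>lborel \<partial>lborel)"
    by (simp only: inner)
  also have "\<dots> = (\<integral>\<^sup>+ t. \<integral>\<^sup>+ \<mu>. f t \<mu> \<partial>lborel \<partial>lborel)"
    by (rule lborel_pair.Fubini') (unfold f_def, measurable)
  also have "\<dots> = (\<integral>\<^sup>+ t. ennreal (inverse t ^ Suc n) * indicator {r..1 / r} t \<partial>lborel)"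
  proof (intro nn_integral_cong)
    fix t :: real
    show "(\<integral>\<^sup>+ \<mu>. f t \<mu> \<partial>lborel) = ennreal (inverse t ^ Suc n) * indicator {r..1 / r} t"
      using nn_integral_power_exp[of t n] r
      by (cases "t \<in> {r..1 / r}") (auto simp: f_def)
  qed
  also have "\<dots> = ennreal (- 2 * ring_mode n r)"
    using r by (intro nn_integral_has_integral_lebesgue' has_integral_inverse_power) auto
  finally show "(\<integral>\<^sup>+ \<mu>. ennreal (radial_kernel r n \<mu>) \<partial>lborel) = ennreal (- 2 * ring_mode n r)" .
qed (use radial_kernel_nonneg[OF r] ring_mode_neg[OF r, of n] in auto)

text \<open>The power series of the inner integral is integrated term by term over the half-line.
  This is justified by summability of the integrals of absolute values, which \<open>summ\<close>
  provides.\<close>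

lemma cauchy_kernel_has_integral:
  fixes h :: "real \<Rightarrow> real"
  assumes r: "0 < r" "r < 1"
    and cont: "continuous_on {0..2 * pi} h"
    and summ: "summable (\<lambda>n. \<bar>ring_mode n r\<bar> * norm (fourier_coeff h n))"
  shows "(cauchy_kernel_integrand h r \<phi> has_integral
     (\<Sum>n. 2 * mode_weight n * ring_mode n r * Re (fourier_coeff h n * cis (real n * \<phi>)))) {0<..}"
proof -
  define c where "c n = mode_weight n * Re (fourier_coeff h n * cis (real n * \<phi>))" for n
  \<comment> \<open>The minus sign undoes the reversed bracket of
    \<open>radial_kernel\<close>.\<close>
  define F where "F n \<mu> = - c n * radial_kernel r n \<mu>" for n \<mu>
  have c_le: "\<bar>c n\<bar> \<le> 2 * pi * norm (fourier_coeff h n)" for n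
    unfolding c_def abs_mult by (intro mult_mono abs_Re_mult_cis_le) (auto simp: mode_weight_def)
  have F: "has_bochner_integral lborel (F n) (2 * c n * ring_mode n r)" for n
    using has_bochner_integral_mult_right[OF has_bochner_integral_radial_kernel[OF r, of n], of "- c n"]
    by (simp add: F_def[abs_def] mult_ac)
  have pointwise: "(\<lambda>n. F n \<mu>) sums (indicator {0<..} \<mu> * cauchy_kernel_integrand h r \<phi> \<mu>)" for \<mu>
  proof -
    have "(\<lambda>n. - (indicator {0<..} \<mu> * (1 / \<mu> * (exp (- \<mu> * r) - exp (- \<mu> / r)))) *
        (\<mu> ^ n / fact n * c n)) sums (- (indicator {0<..} \<mu> * (1 / \<mu> * (exp (- \<mu> * r) - exp (- \<mu> / r)))) *
        integral {0..2 * pi} (\<lambda>\<psi>. exp (\<mu> * cos (\<phi> - \<psi>)) * cos (\<mu> * sin (\<phi> - \<psi>)) * h \<psi>))"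
      unfolding c_def by (intro sums_mult inner_integral_sums cont)
    then show ?thesis
      by (simp add: F_def radial_kernel_def cauchy_kernel_integrand_def algebra_simps)
  qed
  obtain B where B: "\<And>\<theta>. \<theta> \<in> {0..2 * pi} \<Longrightarrow> \<bar>h \<theta>\<bar> \<le> B"
    using continuous_on_Icc_abs_bounded[OF cont] by blast
  have summable_F: "summable (\<lambda>n. norm (F n \<mu>))" for \<mu>
  proof (rule summable_comparison_test')
    let ?K = "indicator {0<..} \<mu> * (1 / \<mu> * (exp (- \<mu> * r) - exp (- \<mu> / r)))"
    show "summable (\<lambda>n. 2 * pi * (2 * B) * (\<bar>?K\<bar> * (\<bar>\<mu>\<bar> ^ n / fact n)))"
      using summable_exp[of "\<bar>\<mu>\<bar>"] by (intro summable_mult) (simp add: field_simps)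
    fix n :: nat
    have "norm (norm (F n \<mu>)) = \<bar>c n\<bar> * (\<bar>?K\<bar> * (\<bar>\<mu>\<bar> ^ n / fact n))"
      by (simp add: F_def radial_kernel_def abs_mult power_abs)
    also have "\<dots> \<le> 2 * pi * (2 * B) * (\<bar>?K\<bar> * (\<bar>\<mu>\<bar> ^ n / fact n))"
      by (intro mult_right_mono order.trans[OF c_le] mult_left_mono norm_fourier_coeff_le cont B) auto
    finally show "norm (norm (F n \<mu>)) \<le> 2 * pi * (2 * B) * (\<bar>?K\<bar> * (\<bar>\<mu>\<bar> ^ n / fact n))" .
  qed
  have summable_integral_F: "summable (\<lambda>n. \<integral>\<mu>. norm (F n \<mu>) \<partial>lborel)"
  proof (rule summable_comparison_test')
    show "summable (\<lambda>n. 4 * pi * (\<bar>ring_mode n r\<bar> * norm (fourier_coeff h n)))"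
      by (intro summable_mult summ)
    fix n :: nat
    \<comment> \<open>As the kernel is nonnegative, the integral of the absolute value is known
      exactly.\<close>
    have "norm (F n \<mu>) = \<bar>c n\<bar> * radial_kernel r n \<mu>" for \<mu>
      using radial_kernel_nonneg[OF r, of n \<mu>] by (simp add: F_def abs_mult)
    then have "(\<integral>\<mu>. norm (F n \<mu>) \<partial>lborel) = \<bar>c n\<bar> * (2 * \<bar>ring_mode n r\<bar>)"
      using has_bochner_integral_integral_eq[OF has_bochner_integral_radial_kernel[OF r, of n]]
        ring_mode_neg[OF r, of n] by simp
    also have "\<dots> \<le> 2 * pi * norm (fourier_coeff h n) * (2 * \<bar>ring_mode n r\<bar>)"
      by (intro mult_right_mono c_le) auto
    finally show "norm (\<integral>\<mu>. norm (F n \<mu>) \<partial>lborel) \<le> 4 * pi * (\<bar>ring_mode n r\<bar> * norm (fourier_coeff h n))"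
      by (simp add: mult_ac)
  qed
  have integrable_F: "integrable lborel (F n)" for n
    using F by (simp add: has_bochner_integral_iff)
  note suminf_F = integrable_F AE_I2[OF summable_F] summable_integral_F
  have "((\<lambda>\<mu>. \<Sum>n. F n \<mu>) has_integral (\<Sum>n. integral\<^sup>L lborel (F n))) UNIV"
    using has_integral_integral_lborel[OF integrable_suminf[OF suminf_F]]
    unfolding integral_suminf[OF suminf_F] .
  then have "((\<lambda>\<mu>. indicator {0<..} \<mu> * cauchy_kernel_integrand h r \<phi> \<mu>) has_integral
      (\<Sum>n. 2 * c n * ring_mode n r)) UNIV"
    by (simp only: sums_unique[OF pointwise] has_bochner_integral_integral_eq[OF F])
  moreover have "(\<lambda>\<mu>. indicator {0<..} \<mu> * cauchy_kernel_integrand h r \<phi> \<mu>)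
      = (\<lambda>\<mu>. if \<mu> \<in> {0<..} then cauchy_kernel_integrand h r \<phi> \<mu> else 0)"
    by (simp add: fun_eq_iff)
  ultimately show ?thesis
    unfolding c_def has_integral_restrict_UNIV by (simp only: has_integral_restrict_UNIV mult_ac)
qed

section \<open>Assembly of the solution formula\<close>

theorem theorem2:
  fixes R :: real and h :: "real \<Rightarrow> real" and u :: "complex \<Rightarrow> real" and r \<phi> :: real
  assumes "0 < R" and "R < 1"
    and "continuous_on UNIV h"
    and "\<And>x. h (x + 2 * pi) = h x"
    and "continuous_on {z. R \<le> cmod z \<and> cmod z \<le> 1} u"
    and "laplace_eq_ring R u"
    and "\<And>\<theta>. u (rcis 1 \<theta>) = 0"
    and "\<And>\<theta>. ((\<lambda>s. u (rcis s \<theta>)) has_real_derivative h \<theta>) (at_left 1)"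
    and "R < r" and "r < 1"
  shows "cauchy_kernel_integrand h r \<phi> integrable_on {0<..} \<and>
         u (rcis r \<phi>) =
           - (1 / (2 * pi)) * integral {0..2 * pi} h * ln r
           + 1 / (2 * pi) * integral {0<..} (cauchy_kernel_integrand h r \<phi>)"
proof -
  define f where "f \<theta> = u (rcis R \<theta>)" for \<theta>
  \<comment> \<open>Coefficients with respect to modes of slope 1 at the outer circle, so that they
    become the coefficients of the normal derivative.\<close>
  define a where "a n = fourier_coeff f n / of_real (ring_mode n R)" for n
  have r: "0 < r" "r < 1" using assms by auto
  have cont_h: "continuous_on {0..2 * pi} h" using assms(3) continuous_on_subset by blast
  have cont_f: "continuous_on {0..2 * pi} f"
    unfolding f_def using assms(1,2)
    by (intro continuous_on_compose2[OF assms(5)])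
       (auto intro!: continuous_intros simp: rcis_def norm_mult)
  have summ: "summable (\<lambda>n. inverse s ^ Suc n * norm (a n))" if "R < s" "s \<le> 1" for s
    unfolding a_def by (rule summable_ring_coeff[OF assms(1) that cont_f])
  have expansion: "(\<lambda>n. ring_mode n t * Re (a n * cis (real n * \<theta>))) sums u (rcis t \<theta>)"
    if "R < t" "t \<le> 1" for t \<theta>
    using ring_fourier_expansion[OF assms(1,2,5) laplace_eq_ring_imp_polar_harmonic[OF assms(6)]
        assms(7) that, of \<theta>]
    by (simp add: a_def f_def[abs_def])
  \<comment> \<open>Any point strictly between \<open>R\<close> and 1 would do: the differentiated
    series has to converge uniformly on \<open>{s..1}\<close>.\<close>
  define s where "s = (R + 1) / 2"
  have s: "R < s" "0 < s" "s < 1" using assms(1,2) by (auto simp: s_def)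
  have h_sums: "(\<lambda>n. Re (a n * cis (real n * \<theta>))) sums h \<theta>" for \<theta>
    by (rule normal_derivative_expansion[OF s(2,3) summ[OF s(1)] _ assms(8)])
       (use s expansion in auto)
  define \<rho> where "\<rho> n = Re (fourier_coeff h n * cis (real n * \<phi>))" for n
  have summ_a: "summable (\<lambda>n. norm (a n))" using summ[of 1] assms by simp
  have coeff_eq: "fourier_coeff h n = (if n = 0 then of_real (Re (a 0)) else a n)" for n
    by (rule fourier_coeff_series[OF summ_a h_sums])
  \<comment> \<open>The imaginary part of \<open>a 0\<close>, where the two coefficient sequences
    may differ, drops out of the real part.\<close>
  have \<rho>: "\<rho> n = Re (a n * cis (real n * \<phi>))" for n
    by (simp add: \<rho>_def coeff_eq)
  have "summable (\<lambda>n. \<bar>ring_mode n r\<bar> * norm (fourier_coeff h n))"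
  proof (rule summable_comparison_test'[OF summ[of r]])
    fix n
    show "norm (\<bar>ring_mode n r\<bar> * norm (fourier_coeff h n)) \<le> inverse r ^ Suc n * norm (a n)"
      using ring_mode_abs_le[of r n] r abs_Re_le_cmod[of "a 0"]
      unfolding real_norm_def abs_mult abs_abs abs_norm_cancel
      by (intro mult_mono) (auto simp: coeff_eq)
  qed (use assms in auto)
  from cauchy_kernel_has_integral[OF r cont_h this, of \<phi>]
  have int: "(cauchy_kernel_integrand h r \<phi> has_integral
      (\<Sum>n. 2 * mode_weight n * ring_mode n r * \<rho> n)) {0<..}"
    by (simp add: \<rho>_def)
  \<comment> \<open>The factor \<open>2 * mode_weight n\<close> is \<open>2 * pi\<close> except at
    \<open>n = 0\<close>, where it is \<open>4 * pi\<close>; the surplus is the logarithmic term,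
    split off as a series with a single entry.\<close>
  have "(\<lambda>n. 2 * pi * (ring_mode n r * \<rho> n) + (if n = 0 then 2 * pi * (ln r * \<rho> n) else 0))
      sums (2 * pi * u (rcis r \<phi>) + 2 * pi * (ln r * \<rho> 0))"
    unfolding \<rho> using expansion[of r \<phi>] assms
    by (intro sums_add sums_mult sums_single) auto
  moreover have "2 * mode_weight n * ring_mode n r * \<rho> n
      = 2 * pi * (ring_mode n r * \<rho> n) + (if n = 0 then 2 * pi * (ln r * \<rho> n) else 0)" for n
    by (simp add: mode_weight_def ring_mode_def)
  ultimately have "(\<Sum>n. 2 * mode_weight n * ring_mode n r * \<rho> n)
      = 2 * pi * u (rcis r \<phi>) + 2 * pi * (ln r * \<rho> 0)"
    by (simp add: sums_iff)
  moreover have "2 * pi * \<rho> 0 = integral {0..2 * pi} h"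
  proof -
    have "integral {0..2 * pi} (\<lambda>\<theta>. complex_of_real (h \<theta>)) = of_real (integral {0..2 * pi} h)"
      using integral_linear[OF integrable_continuous_real[OF cont_h] bounded_linear_of_real]
      by (simp add: o_def)
    then show ?thesis by (simp add: \<rho>_def fourier_coeff_def mode_weight_def)
  qed
  ultimately show ?thesis
    using int pi_gt_zero by (auto simp: integrable_on_def integral_unique field_simps)
qed

end
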